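(* There are constants $c_n, c>0$ depending only on the dimension $n$ such that for every weight $w$ on $\mathbb{R}^n$ and every $b\in\mathrm{BMO}_{1,w}$ the following hold. (1) If $w\in A_1$, then for every $q>1$ and every cube $Q$, $$\left(\frac{1}{w(Q)}\int_Q\left|\frac{b(x)-b_Q}{w(x)}\right|^{q}w(x)\,dx\right)^{1/q}\le c_n\,\|b\|_{\mathrm{BMO}_{1,w}}\;q\,[w]_{A_1}^{1/q'}\,[w]_{A_\infty}^{1/q},$$ and hence for every cube $Q$ $$\left\|\frac{b-b_Q}{w}\right\|_{\exp L(Q,w)}\le c\,[w]_{A_1}\,\|b\|_{\mathrm{BMO}_{1,w}}.$$ (2) If $w\in A_p$ with $1<p<\infty$, then for every cube $Q$, $$\left(\frac{1}{w(Q)}\int_Q\left|\frac{b(x)-b_Q}{w(x)}\right|^{p'}w(x)\,dx\right)^{1/p'}\le c_n\,p'\,\|b\|_{\mathrm{BMO}_{1,w}}\,[w]_{A_p}^{1/p}\,[w]_{A_\infty}^{1/p'}.$$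
   Context: A weight is a non-negative locally integrable function on $\mathbb{R}^n$; $w(Q)=\int_Q w\,dx$. Cubes have sides parallel to the axes, $b_Q=\frac{1}{|Q|}\int_Q b$, and $q'=q/(q-1)$, $p'=p/(p-1)$ are the dual exponents. $\mathrm{BMO}_{1,w}$ is the set of $b\in L^1_{loc}(\mathbb{R}^n)$ with $$\|b\|_{\mathrm{BMO}_{1,w}}=\sup_Q\frac{1}{w(Q)}\int_Q|b-b_Q|\,dx<\infty.$$ $A_1$ and $A_p$ are the Muckenhoupt classes, with $[w]_{A_p}=\sup_Q\left(\frac{1}{|Q|}\int_Q w\right)\left(\frac{1}{|Q|}\int_Q w^{1-p'}\right)^{p-1}$ for $1<p<\infty$, and $[w]_{A_1}$ the smallest constant $C$ with $Mw\le C\,w$ a.e.; $M$ is the Hardy–Littlewood maximal operator, $Mg(x)=\sup_{R\ni x}\frac{1}{|R|}\int_R|g|$ (supremum over cubes $R$ containing $x$). The Fujii–Wilson constant is $[w]_{A_\infty}=\sup_Q\frac{1}{w(Q)}\int_Q M(w\chi_Q)\,dx$. $\|g\|_{\exp L(Q,w)}$ is the Luxemburg norm with respect to the probability measure $\frac{w\,dx}{w(Q)}$ on $Q$: $\|g\|_{\exp L(Q,w)}=\inf\{\lambda>0:\ \frac{1}{w(Q)}\int_Q (e^{|g|/\lambda}-1)\,w\,dx\le1\}$. *)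

theory Defs
  imports "HOL-Analysis.Analysis"
begin

text \<open>
  All norms, averages of non-negative functions and weight constants take values in
  \<^typ>\<open>ennreal\<close>, so a supremum over all cubes may be infinite. There \<open>0 / 0 = 0 * \<infinity> = 0\<close> and
  \<open>x / 0 = \<infinity>\<close> for \<open>x > 0\<close>. These conventions matter for the weights considered only when
  \<open>w = 0\<close> almost everywhere.
\<close>

definition cubes :: "(real ^ 'n) set set" where
  "cubes = {cbox a (a + (\<chi> i. h)) | a h. 0 < h}"

definition locally_integrable :: "(real ^ 'n \<Rightarrow> real) \<Rightarrow> bool" where
  "locally_integrable f \<longleftrightarrow> (\<forall>K. compact K \<longrightarrow> set_integrable lebesgue K f)"

definition weight :: "(real ^ 'n \<Rightarrow> real) \<Rightarrow> bool" where
  "weight w \<longleftrightarrow> (\<forall>x. 0 \<le> w x) \<and> locally_integrable w"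

definition wmass :: "(real ^ 'n \<Rightarrow> real) \<Rightarrow> (real ^ 'n) set \<Rightarrow> ennreal" where
  "wmass w Q = (\<integral>\<^sup>+x\<in>Q. ennreal (w x) \<partial>lebesgue)"

definition mean :: "(real ^ 'n \<Rightarrow> real) \<Rightarrow> (real ^ 'n) set \<Rightarrow> real" where
  "mean b Q = (LINT x:Q|lebesgue. b x) / measure lebesgue Q"

definition nn_avg :: "(real ^ 'n) set \<Rightarrow> (real ^ 'n \<Rightarrow> ennreal) \<Rightarrow> ennreal" where
  "nn_avg Q f = (\<integral>\<^sup>+x\<in>Q. f x \<partial>lebesgue) / emeasure lebesgue Q"

text \<open>The average of \<open>f\<close> over \<open>Q\<close> with respect to \<open>w dx / w(Q)\<close>.\<close>
definition weighted_avg ::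
    "(real ^ 'n \<Rightarrow> real) \<Rightarrow> (real ^ 'n) set \<Rightarrow> (real ^ 'n \<Rightarrow> ennreal) \<Rightarrow> ennreal" where
  "weighted_avg w Q f = (\<integral>\<^sup>+x\<in>Q. f x * ennreal (w x) \<partial>lebesgue) / wmass w Q"

text \<open>Real powers on \<open>[0, \<infinity>]\<close>. For \<open>a < 0\<close> the value at \<open>0\<close> is \<open>\<infinity>\<close> (not \<open>0\<close>, as for
  \<^const>\<open>powr\<close> on the reals), so that \<open>w\<^sup>1\<^sup>-\<^sup>p\<^sup>'\<close> is infinite where \<open>w\<close> vanishes.\<close>
definition enn_powr :: "ennreal \<Rightarrow> real \<Rightarrow> ennreal" where
  "enn_powr x a =
     (if a = 0 then 1
      else if x = \<infinity> then (if 0 < a then \<infinity> else 0)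
      else if x = 0 then (if 0 < a then 0 else \<infinity>)
      else ennreal (enn2real x powr a))"

definition dual_exp :: "real \<Rightarrow> real" where
  "dual_exp q = q / (q - 1)"

definition bmo_norm :: "(real ^ 'n \<Rightarrow> real) \<Rightarrow> (real ^ 'n \<Rightarrow> real) \<Rightarrow> ennreal" where
  "bmo_norm w b =
     (SUP Q\<in>cubes. (\<integral>\<^sup>+x\<in>Q. ennreal \<bar>b x - mean b Q\<bar> \<partial>lebesgue) / wmass w Q)"

definition BMO :: "(real ^ 'n \<Rightarrow> real) \<Rightarrow> (real ^ 'n \<Rightarrow> real) set" where
  "BMO w = {b. locally_integrable b \<and> bmo_norm w b < \<infinity>}"

definition maximal :: "(real ^ 'n \<Rightarrow> real) \<Rightarrow> real ^ 'n \<Rightarrow> ennreal" where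
  "maximal g x = (SUP R\<in>{R \<in> cubes. x \<in> R}. nn_avg R (\<lambda>y. ennreal \<bar>g y\<bar>))"

definition A1_const :: "(real ^ 'n \<Rightarrow> real) \<Rightarrow> ennreal" where
  "A1_const w = Inf {C. AE x in lebesgue. maximal w x \<le> C * ennreal (w x)}"

definition Ap_const :: "real \<Rightarrow> (real ^ 'n \<Rightarrow> real) \<Rightarrow> ennreal" where
  "Ap_const p w =
     (SUP Q\<in>cubes. nn_avg Q (\<lambda>x. ennreal (w x)) *
        enn_powr (nn_avg Q (\<lambda>x. enn_powr (ennreal (w x)) (1 - dual_exp p))) (p - 1))"

text \<open>The Fujii--Wilson constant.\<close>
definition Ainf_const :: "(real ^ 'n \<Rightarrow> real) \<Rightarrow> ennreal" where
  "Ainf_const w =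
     (SUP Q\<in>cubes. (\<integral>\<^sup>+x\<in>Q. maximal (\<lambda>y. w y * indicator Q y) x \<partial>lebesgue) / wmass w Q)"

definition A1_weights :: "(real ^ 'n \<Rightarrow> real) set" where
  "A1_weights = {w. weight w \<and> A1_const w < \<infinity>}"

definition Ap_weights :: "real \<Rightarrow> (real ^ 'n \<Rightarrow> real) set" where
  "Ap_weights p = {w. weight w \<and> Ap_const p w < \<infinity>}"

text \<open>The Luxemburg norm of \<open>g\<close> in \<open>exp L(Q,w)\<close>.\<close>
definition expL_norm ::
    "(real ^ 'n) set \<Rightarrow> (real ^ 'n \<Rightarrow> real) \<Rightarrow> (real ^ 'n \<Rightarrow> real) \<Rightarrow> ennreal" where
  "expL_norm Q w g =
     Inf {ennreal l | l. 0 < l \<and> weighted_avg w Q (\<lambda>x. ennreal (exp (\<bar>g x\<bar> / l) - 1)) \<le> 1}"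

end

theory Submission
  imports Defs
begin

text \<open>
  Both parts are instances of one estimate, \<open>weighted_oscillation_estimate\<close>. Write
  \<open>\<alpha>(Q) = w(Q) / |Q|\<close> and let \<open>B\<close> be the BMO norm of \<open>b\<close>. If \<open>s > 1\<close> and
  \<open>\<alpha>(Q)\<^sup>s\<^sup>-\<^sup>1 \<integral>\<^sub>Q w\<^sup>1\<^sup>-\<^sup>s \<le> K |Q|\<close> for every cube, then the \<open>s\<close>-th moment of \<open>|b - b\<^sub>Q| / w\<close> with
  respect to \<open>w dx / w(Q)\<close> is at most \<open>(C s B)\<^sup>s K [w]\<^sub>A\<^sub>\<infinity>\<close>, where \<open>C\<close> depends on the dimension
  only. For \<open>s = p'\<close> the hypothesis is the \<open>A\<^sub>p\<close> condition with \<open>K = [w]\<^sup>s\<^sup>-\<^sup>1\<close> (\<open>Ap_key\<close>), and taking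
  \<open>s\<close>-th roots gives the exponent \<open>(s - 1) / s = 1 / p\<close>. For \<open>s = q\<close> and \<open>w \<in> A\<^sub>1\<close> it holds with
  \<open>K = [w]\<^sup>q\<^sup>-\<^sup>1\<close>, because \<open>\<alpha>(Q) \<le> [w] w\<close> almost everywhere on \<open>Q\<close> (\<open>A1_key\<close>). The exponential bound
  follows from the growth of the constant in \<open>q\<close>, by expanding \<open>exp\<close> into its power series and
  using \<open>[w]\<^sub>A\<^sub>\<infinity> \<le> [w]\<^sub>A\<^sub>1\<close>.

  The estimate comes from a stopping-time argument. To a cube \<open>P\<close> one attaches the maximal dyadic
  subcubes on which the average of \<open>|b - b\<^sub>P|\<close> exceeds \<open>4 B \<alpha>(P)\<close> (\<open>calderon_zygmund\<close>,
  \<open>stopping_cubes\<close>). They fill at most a quarter of \<open>P\<close>, so iterating from \<open>Q\<close> produces a tree of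
  cubes whose generations shrink geometrically. With \<open>G\<^sub>k = \<alpha>(P)\<close> on the cubes \<open>P\<close> of generation
  \<open>k\<close>, the oscillation \<open>|b - b\<^sub>Q|\<close> is dominated by \<open>B (G\<^sub>0 + G\<^sub>1 + ...)\<close> up to a dimensional factor
  (\<open>oscillation_le_level_sum\<close>).

  It remains to integrate \<open>(G\<^sub>0 + G\<^sub>1 + ...)\<^sup>s\<close> against \<open>\<sigma> = w\<^sup>1\<^sup>-\<^sup>s\<close> (\<open>level_sum_power_le\<close>). Partial
  summation replaces this power by the sum over \<open>k\<close> of \<open>s G\<^sub>k (G\<^sub>k + G\<^sub>k\<^sub>+\<^sub>1 + ...)\<^sup>s\<^sup>-\<^sup>1\<close>. On a cube \<open>P\<close>
  of generation \<open>k\<close> the factor \<open>G\<^sub>k\<close> is constant, and the hypothesis bounds the integral of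
  \<open>G\<^sub>j\<^sup>s\<^sup>-\<^sup>1 \<sigma>\<close> over \<open>P\<close> by \<open>K\<close> times the Lebesgue measure of generation \<open>j\<close> inside \<open>P\<close>, hence by
  \<open>4\<^sup>k\<^sup>-\<^sup>j K |P|\<close>. This decay absorbs the power of the sum at the price of \<open>(C s)\<^sup>s\<^sup>-\<^sup>1\<close>. What is left
  is \<open>K\<close> times the sum of \<open>w(P)\<close> over all cubes of the tree. Each cube keeps three quarters of its
  measure outside its children, and \<open>\<alpha>(P) \<le> M(w \<chi>\<^sub>Q)\<close> on \<open>P\<close>, so this sum is at most
  \<open>4/3 \<integral>\<^sub>Q M(w \<chi>\<^sub>Q)\<close> (\<open>level_sum_integral_le\<close>). This is the only place where the Fujii--Wilson
  constant enters, and it enters with the power one.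

  A weight in \<open>A\<^sub>1\<close> or \<open>A\<^sub>p\<close> is either positive almost everywhere or zero almost everywhere. In the
  second case every left-hand side is \<open>0\<close>, since \<open>0 / 0 = 0\<close>.
\<close>

section \<open>Powers of sums\<close>

text \<open>The graph of the convex function \<open>z\<^sup>s\<close> lies above its tangent at \<open>v\<close>.\<close>
lemma powr_diff_le:
  fixes s :: real
  assumes s: "1 \<le> s" and u: "0 \<le> u" "u \<le> v"
  shows "v powr s - u powr s \<le> s * ((v - u) * v powr (s - 1))"
proof (cases "u = 0 \<or> u = v")
  case True
  have "v powr s = v * v powr (s - 1)"
    using u by (cases "v = 0") (simp_all add: powr_mult_base)
  moreover have "\<dots> \<le> s * (v * v powr (s - 1))"
    using mult_right_mono[OF s, of "v * v powr (s - 1)"] u by simp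
  ultimately show ?thesis using True s by auto
next
  case False
  then have pos: "0 < u" "u < v" using u by auto
  have der: "((\<lambda>z. z powr s) has_real_derivative s * z powr (s - 1)) (at z)"
    if "u \<le> z" for z
    using pos that by (intro has_real_derivative_powr) simp
  obtain z where z: "u < z" "z < v" "v powr s - u powr s = (v - u) * (s * z powr (s - 1))"
    using MVT2[OF pos(2), of "\<lambda>z. z powr s" "\<lambda>z. s * z powr (s - 1)"] der by blast
  have "z powr (s - 1) \<le> v powr (s - 1)"
    using z pos s by (intro powr_mono2) auto
  then have "(v - u) * (s * z powr (s - 1)) \<le> (v - u) * (s * v powr (s - 1))"
    using s pos by (intro mult_left_mono) auto
  then show ?thesis unfolding z(3) by (simp add: mult_ac)
qed

text \<open>Partial summation: with tails \<open>S\<^sub>k = x\<^sub>k + ... + x\<^sub>m\<^sub>-\<^sub>1\<close>, the power \<open>S\<^sub>0\<^sup>s\<close> telescopes into the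
  differences \<open>S\<^sub>k\<^sup>s - S\<^sub>k\<^sub>+\<^sub>1\<^sup>s\<close>, each of which is at most \<open>s x\<^sub>k S\<^sub>k\<^sup>s\<^sup>-\<^sup>1\<close>.\<close>
lemma sum_powr_le_telescoped:
  fixes x :: "nat \<Rightarrow> real"
  assumes s: "1 \<le> s" and x: "\<And>k. 0 \<le> x k"
  shows "(\<Sum>k<m. x k) powr s \<le> s * (\<Sum>k<m. x k * (\<Sum>j=k..<m. x j) powr (s - 1))"
  using x
proof (induction m arbitrary: x)
  case 0
  then show ?case by simp
next
  case (Suc m)
  let ?u = "\<Sum>k<m. x (Suc k)"
  let ?v = "x 0 + ?u"
  have u0: "0 \<le> ?u" using Suc.prems by (simp add: sum_nonneg)
  have x0: "0 \<le> x 0" using Suc.prems by simp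
  have step: "?v powr s - ?u powr s \<le> s * (x 0 * ?v powr (s - 1))"
    using powr_diff_le[OF s u0, of ?v] x0 by simp
  have IH: "?u powr s \<le> s * (\<Sum>k<m. x (Suc k) * (\<Sum>j=k..<m. x (Suc j)) powr (s - 1))"
    using Suc.IH[of "\<lambda>k. x (Suc k)"] Suc.prems by simp
  have tot: "(\<Sum>k<Suc m. x k) = ?v" by (simp add: sum.lessThan_Suc_shift del: sum.lessThan_Suc)
  have tot': "(\<Sum>j=0..<Suc m. x j) = ?v"
    unfolding tot[symmetric] atLeast0LessThan ..
  have sh: "(\<Sum>j=Suc k..<Suc m. x j) = (\<Sum>j=k..<m. x (Suc j))" for k
    by (rule sum.shift_bounds_Suc_ivl)
  have "(\<Sum>k<Suc m. x k * (\<Sum>j=k..<Suc m. x j) powr (s - 1))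
      = x 0 * ?v powr (s - 1) + (\<Sum>k<m. x (Suc k) * (\<Sum>j=k..<m. x (Suc j)) powr (s - 1))"
    by (subst sum.lessThan_Suc_shift) (simp only: tot' sh)
  then show ?case using IH step by (simp only: tot) (simp add: algebra_simps)
qed

text \<open>If \<open>T\<close> is the sum on the right, then \<open>x\<^sub>j \<le> 2\<^sup>-\<^sup>j\<^sup>/\<^sup>N T\<^sup>1\<^sup>/\<^sup>N\<close>, and the geometric series with ratio
  \<open>2\<^sup>-\<^sup>1\<^sup>/\<^sup>N\<close> has a sum of order \<open>N + 1\<close>. The estimate serves in place of Minkowski's inequality and
  covers \<open>N < 1\<close> as well. The weights \<open>2\<^sup>j\<close> are affordable because generations of the stopping tree
  decay like \<open>4\<^sup>-\<^sup>j\<close>.\<close>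
lemma sum_powr_le_geometric:
  fixes x :: "nat \<Rightarrow> real"
  assumes N: "0 < N" and x: "\<And>k. 0 \<le> x k"
  shows "(\<Sum>j<m. x j) powr N \<le> (2 * (N + 1)) powr N * (\<Sum>j<m. 2 ^ j * x j powr N)"
proof -
  define T where "T = (\<Sum>j<m. 2 ^ j * x j powr N)"
  define r where "r = (1/2::real) powr (1 / N)"
  have r0: "0 < r" by (simp add: r_def)
  have T0: "0 \<le> T" unfolding T_def by (intro sum_nonneg) auto
  have xj: "x j \<le> r ^ j * T powr (1 / N)" if "j < m" for j
  proof -
    have "2 ^ j * x j powr N \<le> T"
      unfolding T_def using that by (intro member_le_sum) auto
    then have "x j powr N \<le> (1/2) ^ j * T" by (simp add: field_simps power_divide)
    then have "(x j powr N) powr (1 / N) \<le> ((1/2) ^ j * T) powr (1 / N)"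
      using N by (intro powr_mono2) auto
    moreover have "(x j powr N) powr (1 / N) = x j" using N x by (simp add: powr_powr)
    moreover have "((1/2::real) ^ j * T) powr (1 / N) = r ^ j * T powr (1 / N)"
      using T0 by (simp add: powr_mult r_def powr_realpow[symmetric] powr_powr mult.commute)
    ultimately show ?thesis by simp
  qed
  have rbound: "1 / (1 - r) \<le> 2 * (N + 1)" and r1: "r < 1"
  proof -
    have l2: "1/2 \<le> ln (2::real)" using ln2_ge_two_thirds by linarith
    have "r = exp (- (ln 2 / N))" by (simp add: r_def powr_def ln_div)
    then have e: "1 / r = exp (ln 2 / N)" by (simp add: exp_minus divide_inverse)
    have "1 + ln 2 / N \<le> 1 / r" unfolding e by (rule exp_ge_add_one_self)
    moreover have "1 + 1 / (2 * N) \<le> 1 + ln 2 / N" using N l2 by (simp add: field_simps)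
    ultimately have "1 + 1 / (2 * N) \<le> 1 / r" by linarith
    then have b: "r * (2 * N + 1) \<le> 2 * N" using N r0 by (simp add: field_simps)
    then have b1: "r * (2 * N + 1) < 1 * (2 * N + 1)" by simp
    then show "r < 1" using N by (subst (asm) mult_less_cancel_right) auto
    then have "1 / (1 - r) \<le> 2 * N + 1" using b N by (simp add: field_simps)
    then show "1 / (1 - r) \<le> 2 * (N + 1)" by simp
  qed
  have "(\<Sum>j<m. r ^ j) \<le> 1 / (1 - r)"
  proof -
    have "(\<Sum>j<m. r ^ j) = (1 - r ^ m) / (1 - r)" using r1 sum_gp_strict[of r m] by simp
    also have "\<dots> \<le> 1 / (1 - r)" using r0 r1 by (intro divide_right_mono) auto
    finally show ?thesis .
  qed
  then have gs: "(\<Sum>j<m. r ^ j) \<le> 2 * (N + 1)" using rbound by linarith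
  have "(\<Sum>j<m. x j) \<le> (\<Sum>j<m. r ^ j * T powr (1 / N))" by (intro sum_mono xj) simp
  also have "\<dots> = (\<Sum>j<m. r ^ j) * T powr (1 / N)" by (rule sum_distrib_right[symmetric])
  also have "\<dots> \<le> (2 * (N + 1)) * T powr (1 / N)" by (intro mult_right_mono gs) simp
  finally have "(\<Sum>j<m. x j) powr N \<le> ((2 * (N + 1)) * T powr (1 / N)) powr N"
    using x N by (intro powr_mono2) (auto intro: sum_nonneg)
  also have "\<dots> = (2 * (N + 1)) powr N * T"
    using N T0 by (simp add: powr_mult powr_powr)
  finally show ?thesis by (simp add: T_def)
qed

lemma set_nn_integral_indicator:
  assumes [measurable]: "A \<in> sets M" "B \<in> sets M"
  shows "(\<integral>\<^sup>+x\<in>A. indicator B x \<partial>M) = emeasure M (B \<inter> A)"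
proof -
  have "(\<integral>\<^sup>+x\<in>A. indicator B x \<partial>M) = (\<integral>\<^sup>+x. indicator (B \<inter> A) x \<partial>M)"
    by (intro nn_integral_cong) (auto split: split_indicator)
  then show ?thesis by simp
qed

text \<open>Passes an inequality between integrals from the cells of a countable disjoint family to their union;
  all estimates on generations of the tree are proved cell by cell in this way.\<close>
lemma nn_integral_Union_mono:
  assumes S: "countable S" "disjoint S" "S \<subseteq> sets M"
    and [measurable]: "u \<in> borel_measurable M" "v \<in> borel_measurable M"
    and le: "\<And>P. P \<in> S \<Longrightarrow> (\<integral>\<^sup>+x\<in>P. u x \<partial>M) \<le> (\<integral>\<^sup>+x\<in>P. v x \<partial>M)"
  shows "(\<integral>\<^sup>+x\<in>\<Union>S. u x \<partial>M) \<le> (\<integral>\<^sup>+x\<in>\<Union>S. v x \<partial>M)"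
proof -
  have eq: "(\<integral>\<^sup>+x\<in>\<Union>S. f x \<partial>M) = (\<integral>\<^sup>+P. (\<integral>\<^sup>+x\<in>P. f x \<partial>M) \<partial>count_space S)"
    if [measurable]: "f \<in> borel_measurable M" for f
  proof -
    have Sm: "P \<in> sets M" if "P \<in> S" for P using S that by auto
    have Um: "\<Union>S \<in> sets M" using S by (auto intro: sets.countable_Union)
    have "(\<integral>\<^sup>+x\<in>\<Union>S. f x \<partial>M) = emeasure (density M f) (\<Union>P\<in>S. P)"
      using Um by (subst emeasure_density) auto
    also have "\<dots> = (\<integral>\<^sup>+P. emeasure (density M f) P \<partial>count_space S)"
      using S by (intro emeasure_UN_countable)
        (auto simp: disjoint_family_on_def disjoint_def pairwise_def disjnt_def)
    also have "\<dots> = (\<integral>\<^sup>+P. (\<integral>\<^sup>+x\<in>P. f x \<partial>M) \<partial>count_space S)"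
      using Sm by (intro nn_integral_cong) (auto simp: emeasure_density)
    finally show ?thesis .
  qed
  show ?thesis by (simp add: eq) (auto intro!: nn_integral_mono le)
qed

section \<open>Stopping trees\<close>

text \<open>The abstract form of an iterated stopping-time construction: \<open>stop P\<close> are the children of the
  cell \<open>P\<close>. The factor \<open>1/4\<close> leaves room for the weights \<open>2\<^sup>j\<close> of \<open>sum_powr_le_geometric\<close>.\<close>
locale stopping_tree =
  fixes M :: "'a measure" and cells :: "'a set set" and stop :: "'a set \<Rightarrow> 'a set set" and Q0 :: "'a set"
  assumes cells_sets: "P \<in> cells \<Longrightarrow> P \<in> sets M"
    and cells_finite: "P \<in> cells \<Longrightarrow> emeasure M P < \<infinity>"
    and root: "Q0 \<in> cells"
    and stop_cells: "P \<in> cells \<Longrightarrow> stop P \<subseteq> cells"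
    and stop_countable: "P \<in> cells \<Longrightarrow> countable (stop P)"
    and stop_disjoint: "P \<in> cells \<Longrightarrow> disjoint (stop P)"
    and stop_subset: "P \<in> cells \<Longrightarrow> R \<in> stop P \<Longrightarrow> R \<subseteq> P"
    and stop_small: "P \<in> cells \<Longrightarrow> emeasure M (\<Union>(stop P)) \<le> ennreal (1/4) * emeasure M P"
begin

primrec gen :: "nat \<Rightarrow> 'a set set" where
  "gen 0 = {Q0}"
| "gen (Suc k) = (\<Union>P\<in>gen k. stop P)"

definition cover :: "nat \<Rightarrow> 'a set" where
  "cover k = \<Union>(gen k)"

lemma gen_cells: "gen k \<subseteq> cells"
  by (induction k) (use root stop_cells in auto)

lemma countable_gen: "countable (gen k)"
  by (induction k) (use stop_countable gen_cells in auto)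

lemma disjoint_gen: "disjoint (gen k)"
proof (induction k)
  case 0
  then show ?case by simp
next
  case (Suc k)
  show ?case
  proof (rule disjointI)
    fix R R' assume R: "R \<in> gen (Suc k)" "R' \<in> gen (Suc k)" "R \<noteq> R'"
    obtain P P' where P: "P \<in> gen k" "R \<in> stop P" "P' \<in> gen k" "R' \<in> stop P'" using R by auto
    have c: "P \<in> cells" "P' \<in> cells" using P gen_cells by auto
    show "R \<inter> R' = {}"
    proof (cases "P = P'")
      case True
      then show ?thesis using stop_disjoint[OF c(1)] P R(3) by (auto simp: disjoint_def pairwise_def disjnt_def)
    next
      case False
      then have "P \<inter> P' = {}" using Suc P by (auto simp: disjoint_def pairwise_def disjnt_def)
      then show ?thesis using stop_subset P c by blast
    qed
  qed
qed

lemma gen_unique: "P \<in> gen k \<Longrightarrow> R \<in> gen k \<Longrightarrow> x \<in> P \<Longrightarrow> x \<in> R \<Longrightarrow> P = R"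
  using disjoint_gen[of k] by (auto simp: disjoint_def pairwise_def disjnt_def)

lemma gen_sets: "gen k \<subseteq> sets M"
  using gen_cells cells_sets by blast

lemma cover_sets[measurable]: "cover k \<in> sets M"
  unfolding cover_def using gen_sets countable_gen by (auto intro: sets.countable_Union)

lemma gen_mem_sets: "P \<in> gen k \<Longrightarrow> P \<in> sets M"
  using gen_sets by auto

lemma cover_0: "cover 0 = Q0" by (simp add: cover_def)

lemma cover_Suc_subset: "cover (Suc k) \<subseteq> cover k"
  unfolding cover_def using stop_subset gen_cells by fastforce

lemma cover_antimono: "k \<le> j \<Longrightarrow> cover j \<subseteq> cover k"
  by (induction j rule: dec_induct) (use cover_Suc_subset in auto)

lemma gen_ancestor: "k \<le> j \<Longrightarrow> R \<in> gen j \<Longrightarrow> \<exists>P\<in>gen k. R \<subseteq> P"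
proof (induction j arbitrary: R rule: dec_induct)
  case base
  then show ?case by auto
next
  case (step j)
  obtain P where P: "P \<in> gen j" "R \<in> stop P" using step.prems by auto
  then have "R \<subseteq> P" using stop_subset gen_cells by blast
  then show ?case using step.IH[OF P(1)] by blast
qed

lemma Union_descendants:
  assumes "k \<le> j" "P \<in> gen k"
  shows "\<Union>{R \<in> gen j. R \<subseteq> P} = cover j \<inter> P"
proof
  show "\<Union>{R \<in> gen j. R \<subseteq> P} \<subseteq> cover j \<inter> P" by (auto simp: cover_def)
  show "cover j \<inter> P \<subseteq> \<Union>{R \<in> gen j. R \<subseteq> P}"
  proof
    fix x assume x: "x \<in> cover j \<inter> P"
    then obtain R where R: "R \<in> gen j" "x \<in> R" by (auto simp: cover_def)
    obtain P' where "P' \<in> gen k" "R \<subseteq> P'" using gen_ancestor[OF assms(1) R(1)] by blast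
    moreover have "P' = P" using gen_unique[of P' k P x] calculation R x assms by auto
    ultimately show "x \<in> \<Union>{R \<in> gen j. R \<subseteq> P}" using R by auto
  qed
qed

lemma descendants_mono:
  assumes "k \<le> j" "P \<in> gen k"
    and [measurable]: "u \<in> borel_measurable M" "v \<in> borel_measurable M"
    and le: "\<And>R. R \<in> gen j \<Longrightarrow> R \<subseteq> P \<Longrightarrow> (\<integral>\<^sup>+x\<in>R. u x \<partial>M) \<le> (\<integral>\<^sup>+x\<in>R. v x \<partial>M)"
  shows "(\<integral>\<^sup>+x\<in>cover j \<inter> P. u x \<partial>M) \<le> (\<integral>\<^sup>+x\<in>cover j \<inter> P. v x \<partial>M)"
  unfolding Union_descendants[OF assms(1,2), symmetric]
proof (rule nn_integral_Union_mono)
  show "countable {R \<in> gen j. R \<subseteq> P}" using countable_gen[of j] by (rule countable_subset[rotated]) auto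
  show "disjoint {R \<in> gen j. R \<subseteq> P}" using disjoint_gen[of j] by (rule pairwise_subset) auto
  show "{R \<in> gen j. R \<subseteq> P} \<subseteq> sets M" using gen_sets by auto
qed (use le in auto)

lemma cover_mono:
  assumes "u \<in> borel_measurable M" "v \<in> borel_measurable M"
    and "\<And>R. R \<in> gen j \<Longrightarrow> (\<integral>\<^sup>+x\<in>R. u x \<partial>M) \<le> (\<integral>\<^sup>+x\<in>R. v x \<partial>M)"
  shows "(\<integral>\<^sup>+x\<in>cover j. u x \<partial>M) \<le> (\<integral>\<^sup>+x\<in>cover j. v x \<partial>M)"
  unfolding cover_def using assms countable_gen disjoint_gen gen_sets
  by (intro nn_integral_Union_mono)

lemma cover_Suc_Int: 
  assumes "P \<in> gen k"
  shows "cover (Suc k) \<inter> P = \<Union>(stop P)"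
proof
  show "\<Union>(stop P) \<subseteq> cover (Suc k) \<inter> P"
    using assms stop_subset gen_cells unfolding cover_def by fastforce
  show "cover (Suc k) \<inter> P \<subseteq> \<Union>(stop P)"
  proof
    fix x assume x: "x \<in> cover (Suc k) \<inter> P"
    then obtain R P' where R: "P' \<in> gen k" "R \<in> stop P'" "x \<in> R" unfolding cover_def by auto
    then have "x \<in> P'" using stop_subset gen_cells by blast
    then have "P' = P" using gen_unique[OF R(1) assms] x by auto
    then show "x \<in> \<Union>(stop P)" using R by auto
  qed
qed

lemma emeasure_cover_Suc_Int:
  assumes "P \<in> gen k"
  shows "emeasure M (cover (Suc k) \<inter> P) \<le> ennreal (1/4) * emeasure M P"
  unfolding cover_Suc_Int[OF assms] using assms stop_small gen_cells by blast

text \<open>Descending one generation multiplies the measure inside \<open>P\<close> by at most \<open>1/4\<close>.\<close>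
lemma emeasure_cover_Int:
  assumes "k \<le> j" "P \<in> gen k"
  shows "emeasure M (cover j \<inter> P) \<le> ennreal ((1/4) ^ (j - k)) * emeasure M P"
  using assms(1)
proof (induction j rule: dec_induct)
  case base
  have "P \<in> sets M" using assms gen_mem_sets by auto
  then show ?case by (auto intro!: emeasure_mono)
next
  case (step j)
  have [measurable]: "P \<in> sets M" using assms gen_mem_sets by auto
  have sub: "cover (Suc j) \<inter> P = cover (Suc j) \<inter> (cover j \<inter> P)" using cover_Suc_subset by auto
  have "emeasure M (cover (Suc j) \<inter> P) = (\<integral>\<^sup>+x\<in>cover j \<inter> P. indicator (cover (Suc j)) x \<partial>M)"
    unfolding sub by (subst set_nn_integral_indicator) auto
  also have "\<dots> \<le> (\<integral>\<^sup>+x\<in>cover j \<inter> P. ennreal (1/4) \<partial>M)"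
  proof (rule descendants_mono[OF step.hyps(1) assms(2)])
    fix R assume R: "R \<in> gen j"
    then have [measurable]: "R \<in> sets M" using gen_mem_sets by auto
    have "(\<integral>\<^sup>+x\<in>R. indicator (cover (Suc j)) x \<partial>M) = emeasure M (cover (Suc j) \<inter> R)"
      by (subst set_nn_integral_indicator) auto
    also have "\<dots> \<le> ennreal (1/4) * emeasure M R" by (rule emeasure_cover_Suc_Int[OF R])
    also have "\<dots> = (\<integral>\<^sup>+x\<in>R. ennreal (1/4) \<partial>M)" by (simp add: nn_integral_cmult_indicator)
    finally show "(\<integral>\<^sup>+x\<in>R. indicator (cover (Suc j)) x \<partial>M) \<le> (\<integral>\<^sup>+x\<in>R. ennreal (1/4) \<partial>M)" .
  qed auto
  also have "\<dots> = ennreal (1/4) * emeasure M (cover j \<inter> P)" by (simp add: nn_integral_cmult_indicator)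
  also have "\<dots> \<le> ennreal (1/4) * (ennreal ((1/4) ^ (j - k)) * emeasure M P)"
    by (intro mult_left_mono step.IH) auto
  also have "\<dots> = ennreal ((1/4) ^ (Suc j - k)) * emeasure M P"
    using step.hyps by (simp add: mult.assoc[symmetric] ennreal_mult[symmetric] Suc_diff_le)
  finally show ?case .
qed

text \<open>The cells of one generation are disjoint, so at most one of them contains \<open>x\<close>.\<close>
definition level :: "('a set \<Rightarrow> real) \<Rightarrow> nat \<Rightarrow> 'a \<Rightarrow> real" where
  "level \<alpha> k x = (if x \<in> cover k then \<alpha> (THE P. P \<in> gen k \<and> x \<in> P) else 0)"

lemma level_eq:
  assumes "P \<in> gen k" "x \<in> P"
  shows "level \<alpha> k x = \<alpha> P"
proof -
  have "(THE P. P \<in> gen k \<and> x \<in> P) = P"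
    using assms gen_unique by (intro the_equality) blast+
  then show ?thesis using assms by (auto simp: level_def cover_def)
qed

lemma level_outside: "x \<notin> cover k \<Longrightarrow> level \<alpha> k x = 0"
  by (simp add: level_def)

lemma level_nonneg:
  assumes "\<And>P. P \<in> cells \<Longrightarrow> 0 \<le> \<alpha> P"
  shows "0 \<le> level \<alpha> k x"
proof (cases "x \<in> cover k")
  case True
  then obtain P where P: "P \<in> gen k" "x \<in> P" by (auto simp: cover_def)
  then show ?thesis using level_eq[OF P] gen_cells assms by auto
qed (simp add: level_outside)

lemma level_measurable[measurable]: "level \<alpha> k \<in> borel_measurable M"
proof (rule measurable_piecewise_restrict)
  show "countable (insert (space M - cover k) (gen k))" using countable_gen by simp
  show "space M \<subseteq> \<Union>(insert (space M - cover k) (gen k))" by (auto simp: cover_def)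
next
  fix A assume A: "A \<in> insert (space M - cover k) (gen k)"
  then show "A \<inter> space M \<in> sets M" using gen_mem_sets cover_sets by auto
  obtain c where "level \<alpha> k x = c" if "x \<in> A" for x
    using A level_eq level_outside by (metis DiffD2 insert_iff)
  then show "level \<alpha> k \<in> borel_measurable (restrict_space M A)"
    by (subst measurable_cong[where g="\<lambda>_. c"]) (auto simp: space_restrict_space)
qed

text \<open>The assumption \<open>key\<close> is the abstract \<open>A\<^sub>p\<close> condition, with \<open>\<alpha>(P)\<close> for the average of \<open>w\<close> over \<open>P\<close>
  and \<open>\<sigma>\<close> for \<open>w\<^sup>1\<^sup>-\<^sup>s\<close>.\<close>
context
  fixes \<alpha> :: "'a set \<Rightarrow> real" and \<sigma> :: "'a \<Rightarrow> ennreal" and K :: ennreal and s :: real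
  assumes s: "1 < s"
    and \<alpha>0: "\<And>P. P \<in> cells \<Longrightarrow> 0 \<le> \<alpha> P"
    and \<sigma>[measurable]: "\<sigma> \<in> borel_measurable M"
    and key: "\<And>P. P \<in> cells \<Longrightarrow> ennreal (\<alpha> P powr (s - 1)) * (\<integral>\<^sup>+x\<in>P. \<sigma> x \<partial>M) \<le> K * emeasure M P"
begin

text \<open>On a cell \<open>R\<close> of generation \<open>j\<close> the assumption \<open>key\<close> reads: the integral of \<open>level \<alpha> j\<^sup>s\<^sup>-\<^sup>1 \<sigma>\<close> over
  \<open>R\<close> is at most \<open>K |R|\<close>. Thus the \<open>\<sigma>\<close>-integral inherits the decay of the underlying measure.\<close>
lemma level_power_le:
  assumes "k \<le> j" "P \<in> gen k"
  shows "(\<integral>\<^sup>+x\<in>P. ennreal (level \<alpha> j x powr (s - 1)) * \<sigma> x \<partial>M)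
    \<le> K * ennreal ((1/4) ^ (j - k)) * emeasure M P"
proof -
  have [measurable]: "P \<in> sets M" using assms gen_mem_sets by auto
  have "(\<integral>\<^sup>+x\<in>P. ennreal (level \<alpha> j x powr (s - 1)) * \<sigma> x \<partial>M)
      = (\<integral>\<^sup>+x\<in>cover j \<inter> P. ennreal (level \<alpha> j x powr (s - 1)) * \<sigma> x \<partial>M)"
    by (intro nn_integral_cong) (auto simp: level_outside split: split_indicator)
  also have "\<dots> \<le> (\<integral>\<^sup>+x\<in>cover j \<inter> P. K \<partial>M)"
  proof (rule descendants_mono[OF assms])
    fix R assume R: "R \<in> gen j"
    then have [measurable]: "R \<in> sets M" using gen_mem_sets by auto
    have "(\<integral>\<^sup>+x\<in>R. ennreal (level \<alpha> j x powr (s - 1)) * \<sigma> x \<partial>M)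
        = (\<integral>\<^sup>+x. ennreal (\<alpha> R powr (s - 1)) * (\<sigma> x * indicator R x) \<partial>M)"
      by (intro nn_integral_cong) (auto simp: level_eq[OF R] split: split_indicator)
    also have "\<dots> = ennreal (\<alpha> R powr (s - 1)) * (\<integral>\<^sup>+x\<in>R. \<sigma> x \<partial>M)"
      by (rule nn_integral_cmult) auto
    also have "\<dots> \<le> K * emeasure M R" using key R gen_cells by auto
    also have "\<dots> = (\<integral>\<^sup>+x\<in>R. K \<partial>M)" by (simp add: nn_integral_cmult_indicator)
    finally show "(\<integral>\<^sup>+x\<in>R. ennreal (level \<alpha> j x powr (s - 1)) * \<sigma> x \<partial>M) \<le> (\<integral>\<^sup>+x\<in>R. K \<partial>M)" .
  qed auto
  also have "\<dots> = K * emeasure M (cover j \<inter> P)" by (simp add: nn_integral_cmult_indicator)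
  also have "\<dots> \<le> K * (ennreal ((1/4) ^ (j - k)) * emeasure M P)"
    by (intro mult_left_mono emeasure_cover_Int assms) auto
  finally show ?thesis by (simp add: mult.assoc)
qed

text \<open>The weights \<open>2\<^sup>j\<^sup>-\<^sup>k\<close> from \<open>sum_powr_le_geometric\<close> meet the decay \<open>4\<^sup>k\<^sup>-\<^sup>j\<close> of \<open>level_power_le\<close>; the
  remaining geometric series has the sum \<open>2\<close>.\<close>
lemma level_tail_le:
  assumes "P \<in> gen k"
  shows "(\<integral>\<^sup>+x\<in>P. ennreal ((\<Sum>j=k..<m. level \<alpha> j x) powr (s - 1)) * \<sigma> x \<partial>M)
    \<le> ennreal (2 * (2 * s) powr (s - 1)) * K * emeasure M P"
proof -
  have [measurable]: "P \<in> sets M" using assms gen_mem_sets by auto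
  define C where "C = (2 * s) powr (s - 1)"
  have C0: "0 \<le> C" by (simp add: C_def)
  have shift: "(\<Sum>j=k..<m. f j) = (\<Sum>i<m-k. f (k + i))" for f :: "nat \<Rightarrow> 'b::comm_monoid_add"
    by (rule sum.reindex_bij_witness[of _ "\<lambda>i. k + i" "\<lambda>j. j - k"]) auto
  have pw: "ennreal ((\<Sum>j=k..<m. level \<alpha> j x) powr (s - 1))
     \<le> ennreal C * (\<Sum>i<m-k. ennreal (2 ^ i) * ennreal (level \<alpha> (k + i) x powr (s - 1)))" for x
  proof -
    have "(\<Sum>j=k..<m. level \<alpha> j x) powr (s - 1)
        \<le> C * (\<Sum>i<m-k. 2 ^ i * level \<alpha> (k + i) x powr (s - 1))"
      unfolding shift C_def
      using sum_powr_le_geometric[of "s - 1" "\<lambda>i. level \<alpha> (k + i) x" "m - k"] s \<alpha>0 level_nonneg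
      by simp
    then have "ennreal ((\<Sum>j=k..<m. level \<alpha> j x) powr (s - 1))
        \<le> ennreal (C * (\<Sum>i<m-k. 2 ^ i * level \<alpha> (k + i) x powr (s - 1)))"
      by (rule ennreal_leI)
    also have "\<dots> = ennreal C * (\<Sum>i<m-k. ennreal (2 ^ i) * ennreal (level \<alpha> (k + i) x powr (s - 1)))"
      using C0 by (subst ennreal_mult) (auto simp: sum_nonneg ennreal_mult[symmetric] intro!: sum_nonneg)
    finally show ?thesis .
  qed
  have "(\<integral>\<^sup>+x\<in>P. ennreal ((\<Sum>j=k..<m. level \<alpha> j x) powr (s - 1)) * \<sigma> x \<partial>M)
     \<le> (\<integral>\<^sup>+x. ennreal C * (\<Sum>i<m-k. ennreal (2 ^ i) * (ennreal (level \<alpha> (k + i) x powr (s - 1)) * \<sigma> x * indicator P x)) \<partial>M)"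
  proof (rule nn_integral_mono)
    fix x
    have "ennreal ((\<Sum>j=k..<m. level \<alpha> j x) powr (s - 1)) * \<sigma> x * indicator P x
      \<le> ennreal C * (\<Sum>i<m-k. ennreal (2 ^ i) * ennreal (level \<alpha> (k + i) x powr (s - 1))) * \<sigma> x * indicator P x"
      by (intro mult_right_mono pw) auto
    then show "ennreal ((\<Sum>j=k..<m. level \<alpha> j x) powr (s - 1)) * \<sigma> x * indicator P x
      \<le> ennreal C * (\<Sum>i<m-k. ennreal (2 ^ i) * (ennreal (level \<alpha> (k + i) x powr (s - 1)) * \<sigma> x * indicator P x))"
      by (simp add: sum_distrib_right sum_distrib_left mult.assoc)
  qed
  also have "\<dots> = ennreal C * (\<Sum>i<m-k. ennreal (2 ^ i) * (\<integral>\<^sup>+x\<in>P. ennreal (level \<alpha> (k + i) x powr (s - 1)) * \<sigma> x \<partial>M))"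
    by (subst nn_integral_cmult, simp, subst nn_integral_sum, simp, subst nn_integral_cmult) auto
  also have "\<dots> \<le> ennreal C * (\<Sum>i<m-k. ennreal (2 ^ i) * (K * ennreal ((1/4) ^ i) * emeasure M P))"
  proof (intro mult_left_mono sum_mono)
    fix i
    show "(\<integral>\<^sup>+x\<in>P. ennreal (level \<alpha> (k + i) x powr (s - 1)) * \<sigma> x \<partial>M) \<le> K * ennreal ((1/4) ^ i) * emeasure M P"
      using level_power_le[of k "k + i" P] assms by simp
  qed auto
  also have "\<dots> = ennreal C * (\<Sum>i<m-k. ennreal ((1/2) ^ i)) * K * emeasure M P"
  proof -
    have h: "ennreal (2 ^ i) * (K * ennreal ((1/4) ^ i) * emeasure M P) = ennreal ((1/2) ^ i) * (K * emeasure M P)" for i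
    proof -
      have "(1/2::real) ^ i = 2 ^ i * (1/4) ^ i" by (simp add: power_mult_distrib[symmetric])
      then have "ennreal ((1/2) ^ i) = ennreal (2 ^ i) * ennreal ((1/4) ^ i)"
        by (subst ennreal_mult[symmetric]) auto
      then show ?thesis by (simp add: mult_ac)
    qed
    show ?thesis unfolding h by (simp add: sum_distrib_right[symmetric] mult.assoc)
  qed
  also have "\<dots> \<le> ennreal C * ennreal 2 * K * emeasure M P"
  proof -
    have "(\<Sum>i<m-k. (1/2::real) ^ i) \<le> 2"
      using sum_gp_strict[of "1/2::real" "m-k"] by simp
    then have "(\<Sum>i<m-k. ennreal ((1/2) ^ i)) \<le> ennreal 2"
      by (subst sum_ennreal, simp, intro ennreal_leI)
    then show ?thesis by (intro mult_right_mono mult_left_mono) auto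
  qed
  also have "\<dots> = ennreal (2 * (2 * s) powr (s - 1)) * K * emeasure M P"
    unfolding C_def[symmetric] using C0 by (simp add: ennreal_mult mult_ac)
  finally show ?thesis .
qed

text \<open>Partial summation leaves the factor \<open>level \<alpha> k\<close>, which is constant on a cell of generation \<open>k\<close>,
  next to the tail controlled by \<open>level_tail_le\<close>. The sum on the right keeps the first power of the
  levels; this is why the final bound is linear in the Fujii--Wilson constant.\<close>
lemma level_sum_power_le:
  "(\<integral>\<^sup>+x. ennreal ((\<Sum>k<m. level \<alpha> k x) powr s) * \<sigma> x \<partial>M)
    \<le> ennreal ((2 * s) powr s) * K * (\<Sum>k<m. \<integral>\<^sup>+x\<in>cover k. ennreal (level \<alpha> k x) \<partial>M)"
proof -
  define C where "C = 2 * (2 * s) powr (s - 1)"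
  have C0: "0 \<le> C" by (simp add: C_def)
  have sC: "s * C = (2 * s) powr s"
    using s powr_mult_base[of "2 * s" "s - 1"] by (simp add: C_def)
  let ?t = "\<lambda>k x. (\<Sum>j=k..<m. level \<alpha> j x) powr (s - 1)"
  have pw: "ennreal ((\<Sum>k<m. level \<alpha> k x) powr s) \<le> ennreal s * (\<Sum>k<m. ennreal (level \<alpha> k x) * ennreal (?t k x))" for x
  proof -
    have nn: "0 \<le> level \<alpha> k x" for k using \<alpha>0 by (rule level_nonneg)
    have "(\<Sum>k<m. level \<alpha> k x) powr s \<le> s * (\<Sum>k<m. level \<alpha> k x * ?t k x)"
      using s nn by (intro sum_powr_le_telescoped) auto
    then have "ennreal ((\<Sum>k<m. level \<alpha> k x) powr s) \<le> ennreal (s * (\<Sum>k<m. level \<alpha> k x * ?t k x))"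
      by (rule ennreal_leI)
    also have "\<dots> = ennreal s * (\<Sum>k<m. ennreal (level \<alpha> k x) * ennreal (?t k x))"
      using s nn by (subst ennreal_mult) (auto simp: ennreal_mult[symmetric] intro!: sum_nonneg)
    finally show ?thesis .
  qed
  have "(\<integral>\<^sup>+x. ennreal ((\<Sum>k<m. level \<alpha> k x) powr s) * \<sigma> x \<partial>M)
    \<le> (\<integral>\<^sup>+x. ennreal s * (\<Sum>k<m. ennreal (level \<alpha> k x) * ennreal (?t k x) * \<sigma> x) \<partial>M)"
  proof (rule nn_integral_mono)
    fix x
    have "ennreal ((\<Sum>k<m. level \<alpha> k x) powr s) * \<sigma> x
      \<le> ennreal s * (\<Sum>k<m. ennreal (level \<alpha> k x) * ennreal (?t k x)) * \<sigma> x"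
      by (intro mult_right_mono pw) auto
    then show "ennreal ((\<Sum>k<m. level \<alpha> k x) powr s) * \<sigma> x
      \<le> ennreal s * (\<Sum>k<m. ennreal (level \<alpha> k x) * ennreal (?t k x) * \<sigma> x)"
      by (simp add: sum_distrib_right mult.assoc)
  qed
  also have "\<dots> = ennreal s * (\<Sum>k<m. \<integral>\<^sup>+x. ennreal (level \<alpha> k x) * ennreal (?t k x) * \<sigma> x \<partial>M)"
    by (subst nn_integral_cmult, simp, subst nn_integral_sum) auto
  also have "\<dots> \<le> ennreal s * (\<Sum>k<m. ennreal C * K * (\<integral>\<^sup>+x\<in>cover k. ennreal (level \<alpha> k x) \<partial>M))"
  proof (intro mult_left_mono sum_mono)
    fix k
    have "(\<integral>\<^sup>+x. ennreal (level \<alpha> k x) * ennreal (?t k x) * \<sigma> x \<partial>M)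
        = (\<integral>\<^sup>+x\<in>cover k. ennreal (level \<alpha> k x) * ennreal (?t k x) * \<sigma> x \<partial>M)"
      by (intro nn_integral_cong) (auto simp: level_outside split: split_indicator)
    also have "\<dots> \<le> (\<integral>\<^sup>+x\<in>cover k. ennreal C * K * ennreal (level \<alpha> k x) \<partial>M)"
    proof (rule cover_mono)
      fix P assume P: "P \<in> gen k"
      then have [measurable]: "P \<in> sets M" using gen_mem_sets by auto
      have "(\<integral>\<^sup>+x\<in>P. ennreal (level \<alpha> k x) * ennreal (?t k x) * \<sigma> x \<partial>M)
          = (\<integral>\<^sup>+x. ennreal (\<alpha> P) * (ennreal (?t k x) * \<sigma> x * indicator P x) \<partial>M)"
        by (intro nn_integral_cong) (auto simp: level_eq[OF P] mult.assoc split: split_indicator)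
      also have "\<dots> = ennreal (\<alpha> P) * (\<integral>\<^sup>+x\<in>P. ennreal (?t k x) * \<sigma> x \<partial>M)"
        by (rule nn_integral_cmult) auto
      also have "\<dots> \<le> ennreal (\<alpha> P) * (ennreal C * K * emeasure M P)"
        unfolding C_def by (intro mult_left_mono level_tail_le P) auto
      also have "\<dots> = (\<integral>\<^sup>+x. (ennreal C * K * ennreal (\<alpha> P)) * indicator P x \<partial>M)"
        by (subst nn_integral_cmult_indicator) (auto simp: mult_ac)
      also have "\<dots> = (\<integral>\<^sup>+x\<in>P. ennreal C * K * ennreal (level \<alpha> k x) \<partial>M)"
        by (intro nn_integral_cong) (auto simp: level_eq[OF P] split: split_indicator)
      finally show "(\<integral>\<^sup>+x\<in>P. ennreal (level \<alpha> k x) * ennreal (?t k x) * \<sigma> x \<partial>M)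
        \<le> (\<integral>\<^sup>+x\<in>P. ennreal C * K * ennreal (level \<alpha> k x) \<partial>M)" .
    qed auto
    also have "\<dots> = ennreal C * K * (\<integral>\<^sup>+x\<in>cover k. ennreal (level \<alpha> k x) \<partial>M)"
      by (subst nn_integral_cmult[symmetric]) (auto simp: mult.assoc)
    finally show "(\<integral>\<^sup>+x. ennreal (level \<alpha> k x) * ennreal (?t k x) * \<sigma> x \<partial>M)
      \<le> ennreal C * K * (\<integral>\<^sup>+x\<in>cover k. ennreal (level \<alpha> k x) \<partial>M)" .
  qed auto
  also have "\<dots> = ennreal (s * C) * K * (\<Sum>k<m. \<integral>\<^sup>+x\<in>cover k. ennreal (level \<alpha> k x) \<partial>M)"
    using s C0 by (simp add: sum_distrib_left[symmetric] ennreal_mult mult_ac)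
  finally show ?thesis unfolding sC .
qed

end

text \<open>A Carleson embedding: each cell keeps three quarters of its measure outside the next generation,
  and the sets \<open>cover k - cover (Suc k)\<close> are disjoint. The function \<open>u\<close> stands for a maximal
  function, so the comparison with it is pointwise, after the integrals over the pieces are added up.\<close>
lemma level_sum_integral_le:
  assumes le: "\<And>k x. x \<in> cover k \<Longrightarrow> ennreal (level \<alpha> k x) \<le> u x"
  shows "(\<Sum>k<m. \<integral>\<^sup>+x\<in>cover k. ennreal (level \<alpha> k x) \<partial>M) \<le> ennreal (4/3) * (\<integral>\<^sup>+x\<in>Q0. u x \<partial>M)"
proof -
  let ?D = "\<lambda>k. cover k - cover (Suc k)"
  \<comment> \<open>The constant \<open>4/3\<close> compensates for the at most one quarter of each cell that is covered again.\<close>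
  have one: "(\<integral>\<^sup>+x\<in>cover k. ennreal (level \<alpha> k x) \<partial>M) \<le> ennreal (4/3) * (\<integral>\<^sup>+x\<in>?D k. ennreal (level \<alpha> k x) \<partial>M)" for k
  proof -
    have "(\<integral>\<^sup>+x\<in>cover k. ennreal (level \<alpha> k x) \<partial>M)
        \<le> (\<integral>\<^sup>+x\<in>cover k. ennreal (4/3) * (ennreal (level \<alpha> k x) * indicator (?D k) x) \<partial>M)"
    proof (rule cover_mono)
      fix P assume P: "P \<in> gen k"
      then have [measurable]: "P \<in> sets M" using gen_mem_sets by auto
      have fin: "emeasure M P < \<infinity>" using cells_finite P gen_cells by auto
      have "emeasure M P = emeasure M (P - cover (Suc k)) + emeasure M (cover (Suc k) \<inter> P)"
        by (subst plus_emeasure) (auto intro!: arg_cong[where f="emeasure M"])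
      also have "\<dots> \<le> emeasure M (P - cover (Suc k)) + ennreal (1/4) * emeasure M P"
        by (intro add_left_mono emeasure_cover_Suc_Int P)
      finally have le1: "emeasure M P \<le> emeasure M (P - cover (Suc k)) + ennreal (1/4) * emeasure M P" .
      have big: "emeasure M P \<le> ennreal (4/3) * emeasure M (P - cover (Suc k))"
      proof -
        have fin': "emeasure M (P - cover (Suc k)) < \<infinity>"
          using fin by (rule order_le_less_trans[rotated]) (auto intro!: emeasure_mono)
        obtain p where p: "emeasure M P = ennreal p" "0 \<le> p" using fin by (cases "emeasure M P") auto
        obtain d where d: "emeasure M (P - cover (Suc k)) = ennreal d" "0 \<le> d"
          using fin' by (cases "emeasure M (P - cover (Suc k))") auto
        have "ennreal p \<le> ennreal (d + 1/4 * p)"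
          using le1 p d by (simp add: ennreal_mult[symmetric] ennreal_plus[symmetric] del: ennreal_plus)
        then have "p \<le> 4/3 * d" using p d by (subst (asm) ennreal_le_iff) auto
        then show ?thesis unfolding p d using d by (simp add: ennreal_mult[symmetric] ennreal_leI)
      qed
      have "(\<integral>\<^sup>+x\<in>P. ennreal (level \<alpha> k x) \<partial>M) = (\<integral>\<^sup>+x. ennreal (\<alpha> P) * indicator P x \<partial>M)"
        by (intro nn_integral_cong) (auto simp: level_eq[OF P] split: split_indicator)
      also have "\<dots> = ennreal (\<alpha> P) * emeasure M P" by (subst nn_integral_cmult_indicator) auto
      also have "\<dots> \<le> ennreal (\<alpha> P) * (ennreal (4/3) * emeasure M (P - cover (Suc k)))"
        by (intro mult_left_mono big) auto
      also have "\<dots> = (\<integral>\<^sup>+x. (ennreal (4/3) * ennreal (\<alpha> P)) * indicator (P - cover (Suc k)) x \<partial>M)"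
        by (subst nn_integral_cmult_indicator) (auto simp: mult_ac)
      also have "\<dots> = (\<integral>\<^sup>+x\<in>P. ennreal (4/3) * (ennreal (level \<alpha> k x) * indicator (?D k) x) \<partial>M)"
        using P by (intro nn_integral_cong)
          (auto simp: level_eq[OF P] cover_def split: split_indicator)
      finally show "(\<integral>\<^sup>+x\<in>P. ennreal (level \<alpha> k x) \<partial>M)
        \<le> (\<integral>\<^sup>+x\<in>P. ennreal (4/3) * (ennreal (level \<alpha> k x) * indicator (?D k) x) \<partial>M)" .
    qed auto
    also have "\<dots> = (\<integral>\<^sup>+x. ennreal (4/3) * (ennreal (level \<alpha> k x) * indicator (?D k) x) \<partial>M)"
      by (intro nn_integral_cong) (auto split: split_indicator)
    also have "\<dots> = ennreal (4/3) * (\<integral>\<^sup>+x\<in>?D k. ennreal (level \<alpha> k x) \<partial>M)"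
      by (rule nn_integral_cmult) auto
    finally show ?thesis .
  qed
  have tel: "(\<Sum>k<m. indicator (?D k) x) = (indicator (cover 0 - cover m) x :: ennreal)" for x
  proof (induction m)
    case (Suc m)
    have "cover m \<subseteq> cover 0" "cover (Suc m) \<subseteq> cover m" using cover_antimono by auto
    then show ?case using Suc by (auto split: split_indicator)
  qed simp
  have "(\<Sum>k<m. \<integral>\<^sup>+x\<in>cover k. ennreal (level \<alpha> k x) \<partial>M)
      \<le> (\<Sum>k<m. ennreal (4/3) * (\<integral>\<^sup>+x\<in>?D k. ennreal (level \<alpha> k x) \<partial>M))"
    by (intro sum_mono one)
  also have "\<dots> = ennreal (4/3) * (\<integral>\<^sup>+x. (\<Sum>k<m. ennreal (level \<alpha> k x) * indicator (?D k) x) \<partial>M)"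
    by (subst nn_integral_sum) (auto simp: sum_distrib_left)
  also have "\<dots> \<le> ennreal (4/3) * (\<integral>\<^sup>+x\<in>Q0. u x \<partial>M)"
  proof (intro mult_left_mono nn_integral_mono)
    fix x
    have "(\<Sum>k<m. ennreal (level \<alpha> k x) * indicator (?D k) x) \<le> (\<Sum>k<m. u x * indicator (?D k) x)"
      by (intro sum_mono) (auto simp: le split: split_indicator)
    also have "\<dots> = u x * indicator (cover 0 - cover m) x" by (simp add: sum_distrib_left[symmetric] tel)
    also have "\<dots> \<le> u x * indicator Q0 x" by (auto simp: cover_0 split: split_indicator)
    finally show "(\<Sum>k<m. ennreal (level \<alpha> k x) * indicator (?D k) x) \<le> u x * indicator Q0 x" .
  qed auto
  finally show ?thesis .
qed

text \<open>Follow the cells that contain \<open>x\<close> down the tree: each step changes the reference value \<open>\<beta>\<close> by at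
  most \<open>c \<alpha>\<close>, and in the last cell containing \<open>x\<close> the function itself is within \<open>c \<alpha>\<close> of it.\<close>
lemma oscillation_le_level_sum:
  assumes c: "0 \<le> c" and \<alpha>0: "\<And>P. P \<in> cells \<Longrightarrow> 0 \<le> \<alpha> P"
    and jump: "\<And>P R. P \<in> cells \<Longrightarrow> R \<in> stop P \<Longrightarrow> \<bar>\<beta> R - \<beta> P\<bar> \<le> c * \<alpha> P"
    and final: "\<And>k P. P \<in> gen k \<Longrightarrow> x \<in> P - \<Union>(stop P) \<Longrightarrow> \<bar>f x - \<beta> P\<bar> \<le> c * \<alpha> P"
    and x: "x \<in> Q0" "x \<notin> cover m"
  shows "\<bar>f x - \<beta> Q0\<bar> \<le> c * (\<Sum>k<m. level \<alpha> k x)"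
proof -
  have nn: "0 \<le> level \<alpha> k x" for k using \<alpha>0 by (rule level_nonneg)
  have chain: "\<bar>\<beta> P - \<beta> Q0\<bar> \<le> c * (\<Sum>j<k. level \<alpha> j x)" if "P \<in> gen k" "x \<in> P" for k P
    using that
  proof (induction k arbitrary: P)
    case (Suc k)
    obtain P' where P': "P' \<in> gen k" "P \<in> stop P'" using Suc.prems by auto
    have "x \<in> P'" using P' Suc.prems stop_subset gen_cells by blast
    have "\<bar>\<beta> P - \<beta> P'\<bar> \<le> c * level \<alpha> k x"
      using jump[of P' P] P' gen_cells level_eq[OF P'(1) \<open>x \<in> P'\<close>] by auto
    moreover have "\<bar>\<beta> P' - \<beta> Q0\<bar> \<le> c * (\<Sum>j<k. level \<alpha> j x)"
      using Suc.IH P' \<open>x \<in> P'\<close> by blast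
    ultimately show ?case by (simp add: algebra_simps)
  qed simp
  obtain k where k: "x \<in> cover k" "x \<notin> cover (Suc k)" "k < m"
  proof -
    define l where "l = (LEAST l. x \<notin> cover l)"
    have l: "x \<notin> cover l" unfolding l_def using x(2) by (rule LeastI)
    have lm: "l \<le> m" unfolding l_def using x(2) by (rule Least_le)
    have "l \<noteq> 0"
    proof
      assume "l = 0"
      then show False using l x by (simp add: cover_0)
    qed
    then obtain k where kl: "l = Suc k" by (cases l) auto
    have "x \<in> cover k" using not_less_Least[of k "\<lambda>l. x \<notin> cover l"] kl l_def by auto
    then show thesis using that l lm kl by auto
  qed
  obtain P where P: "P \<in> gen k" "x \<in> P" using k by (auto simp: cover_def)
  have "x \<notin> \<Union>(stop P)" using k(2) P by (auto simp: cover_def)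
  then have "\<bar>f x - \<beta> P\<bar> \<le> c * level \<alpha> k x" using final P level_eq[OF P] by auto
  moreover have "\<bar>\<beta> P - \<beta> Q0\<bar> \<le> c * (\<Sum>j<k. level \<alpha> j x)" using chain P by blast
  ultimately have "\<bar>f x - \<beta> Q0\<bar> \<le> c * (\<Sum>j<Suc k. level \<alpha> j x)" by (simp add: algebra_simps)
  also have "\<dots> \<le> c * (\<Sum>j<m. level \<alpha> j x)"
    using k nn c by (intro mult_left_mono sum_mono2) auto
  finally show ?thesis .
qed

lemma AE_outside_cover: "AE x in M. \<exists>m. x \<notin> cover m"
proof -
  have [measurable]: "(\<Inter>m. cover m) \<in> sets M" by auto
  have "emeasure M (\<Inter>m. cover m) \<le> ennreal ((1/4) ^ m) * emeasure M Q0" for m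
  proof -
    have "emeasure M (\<Inter>m. cover m) \<le> emeasure M (cover m \<inter> Q0)"
      using cover_antimono[of 0 m] root cells_sets by (intro emeasure_mono) (auto simp: cover_0)
    also have "\<dots> \<le> ennreal ((1/4) ^ m) * emeasure M Q0" using emeasure_cover_Int[of 0 m Q0] by simp
    finally show ?thesis .
  qed
  moreover obtain q where q: "emeasure M Q0 = ennreal q" "0 \<le> q"
    using cells_finite[OF root] by (cases "emeasure M Q0") auto
  ultimately have "emeasure M (\<Inter>m. cover m) \<le> ennreal ((1/4) ^ m * q)" for m
    by (metis ennreal_mult' zero_le_divide_1_iff zero_le_numeral zero_le_power)
  moreover have "(\<lambda>m. ennreal ((1/4) ^ m * q)) \<longlonglongrightarrow> ennreal 0"
    by (intro tendsto_ennrealI tendsto_mult_left_zero LIMSEQ_power_zero) auto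
  ultimately have "emeasure M (\<Inter>m. cover m) \<le> 0"
    by (intro LIMSEQ_le_const) auto
  then have "(\<Inter>m. cover m) \<in> null_sets M" by (auto simp: null_sets_def)
  then have "AE x in M. x \<notin> (\<Inter>m. cover m)" by (rule AE_not_in)
  then show ?thesis by simp
qed

text \<open>The pointwise bound by \<open>m\<close> levels is valid off \<open>cover m\<close>, and the estimates for the level sum do not
  depend on \<open>m\<close>; the sets \<open>Q0 - cover m\<close> exhaust \<open>Q0\<close> up to a null set.\<close>
theorem oscillation_power_integral_le:
  fixes f :: "'a \<Rightarrow> real" and u \<sigma> :: "'a \<Rightarrow> ennreal"
  assumes s: "1 < s" and c: "0 \<le> c"
    and \<alpha>0: "\<And>P. P \<in> cells \<Longrightarrow> 0 \<le> \<alpha> P"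
    and [measurable]: "\<sigma> \<in> borel_measurable M" "f \<in> borel_measurable M"
    and key: "\<And>P. P \<in> cells \<Longrightarrow> ennreal (\<alpha> P powr (s - 1)) * (\<integral>\<^sup>+x\<in>P. \<sigma> x \<partial>M) \<le> K * emeasure M P"
    and jump: "\<And>P R. P \<in> cells \<Longrightarrow> R \<in> stop P \<Longrightarrow> \<bar>\<beta> R - \<beta> P\<bar> \<le> c * \<alpha> P"
    and final: "\<And>P. P \<in> cells \<Longrightarrow> AE x in M. x \<in> P - \<Union>(stop P) \<longrightarrow> \<bar>f x - \<beta> P\<bar> \<le> c * \<alpha> P"
    and u: "\<And>P x. P \<in> cells \<Longrightarrow> P \<subseteq> Q0 \<Longrightarrow> x \<in> P \<Longrightarrow> ennreal (\<alpha> P) \<le> u x"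
  shows "(\<integral>\<^sup>+x\<in>Q0. ennreal (\<bar>f x - \<beta> Q0\<bar> powr s) * \<sigma> x \<partial>M)
    \<le> ennreal (4/3 * (2 * s * c) powr s) * K * (\<integral>\<^sup>+x\<in>Q0. u x \<partial>M)"
proof -
  let ?h = "\<lambda>x. ennreal (\<bar>f x - \<beta> Q0\<bar> powr s) * \<sigma> x"
  have [measurable]: "Q0 \<in> sets M" using root cells_sets by auto
  have AEf: "AE x in M. \<forall>k. \<forall>P\<in>gen k. x \<in> P - \<Union>(stop P) \<longrightarrow> \<bar>f x - \<beta> P\<bar> \<le> c * \<alpha> P"
    using final gen_cells countable_gen by (subst AE_all_countable) (auto simp: AE_ball_countable subset_iff)
  have nn: "0 \<le> level \<alpha> k x" for k x using \<alpha>0 by (rule level_nonneg)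
  have lu: "ennreal (level \<alpha> k x) \<le> u x" if x: "x \<in> cover k" for k x
  proof -
    obtain P where P: "P \<in> gen k" "x \<in> P" using x by (auto simp: cover_def)
    have "P \<subseteq> Q0" using gen_ancestor[of 0 k P] P by auto
    moreover have "P \<in> cells" using P gen_cells by auto
    ultimately show ?thesis using level_eq[OF P] u P by auto
  qed
  have trunc: "(\<integral>\<^sup>+x\<in>Q0 - cover m. ?h x \<partial>M) \<le> ennreal (4/3 * (2 * s * c) powr s) * K * (\<integral>\<^sup>+x\<in>Q0. u x \<partial>M)" for m
  proof -
    have "(\<integral>\<^sup>+x\<in>Q0 - cover m. ?h x \<partial>M)
      \<le> (\<integral>\<^sup>+x. ennreal (c powr s) * (ennreal ((\<Sum>k<m. level \<alpha> k x) powr s) * \<sigma> x) \<partial>M)"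
    proof (rule nn_integral_mono_AE, use AEf in eventually_elim)
      fix x assume ae: "\<forall>k. \<forall>P\<in>gen k. x \<in> P - \<Union>(stop P) \<longrightarrow> \<bar>f x - \<beta> P\<bar> \<le> c * \<alpha> P"
      show "?h x * indicator (Q0 - cover m) x
        \<le> ennreal (c powr s) * (ennreal ((\<Sum>k<m. level \<alpha> k x) powr s) * \<sigma> x)"
      proof (cases "x \<in> Q0 - cover m")
        case True
        have "\<bar>f x - \<beta> Q0\<bar> \<le> c * (\<Sum>k<m. level \<alpha> k x)"
          using True ae by (intro oscillation_le_level_sum c \<alpha>0 jump) auto
        then have "\<bar>f x - \<beta> Q0\<bar> powr s \<le> (c * (\<Sum>k<m. level \<alpha> k x)) powr s"
          using s by (intro powr_mono2) auto
        also have "\<dots> = c powr s * (\<Sum>k<m. level \<alpha> k x) powr s"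
          by (rule powr_mult)
        finally have "ennreal (\<bar>f x - \<beta> Q0\<bar> powr s) \<le> ennreal (c powr s) * ennreal ((\<Sum>k<m. level \<alpha> k x) powr s)"
          by (simp add: ennreal_mult[symmetric] ennreal_leI)
        then have "ennreal (\<bar>f x - \<beta> Q0\<bar> powr s) * \<sigma> x \<le> ennreal (c powr s) * ennreal ((\<Sum>k<m. level \<alpha> k x) powr s) * \<sigma> x"
          by (rule mult_right_mono) simp
        then show ?thesis using True by (simp add: mult.assoc)
      qed simp
    qed
    also have "\<dots> = ennreal (c powr s) * (\<integral>\<^sup>+x. ennreal ((\<Sum>k<m. level \<alpha> k x) powr s) * \<sigma> x \<partial>M)"
      by (rule nn_integral_cmult) simp
    also have "\<dots> \<le> ennreal (c powr s) * (ennreal ((2 * s) powr s) * K *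
        (\<Sum>k<m. \<integral>\<^sup>+x\<in>cover k. ennreal (level \<alpha> k x) \<partial>M))"
      by (intro mult_left_mono level_sum_power_le s \<alpha>0 key) auto
    also have "\<dots> \<le> ennreal (c powr s) * (ennreal ((2 * s) powr s) * K * (ennreal (4/3) * (\<integral>\<^sup>+x\<in>Q0. u x \<partial>M)))"
      by (intro mult_left_mono level_sum_integral_le lu) auto
    also have "\<dots> = ennreal (4/3 * (2 * s * c) powr s) * K * (\<integral>\<^sup>+x\<in>Q0. u x \<partial>M)"
    proof -
      have "(2 * s * c) powr s = (2 * s) powr s * c powr s" by (rule powr_mult)
      then have "ennreal (4/3 * (2 * s * c) powr s) = ennreal (4/3) * ennreal ((2 * s) powr s) * ennreal (c powr s)"
        by (simp only: ennreal_mult' powr_ge_zero mult.assoc)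
      then show ?thesis by (simp only: mult_ac)
    qed
    finally show ?thesis .
  qed
  let ?N = "density M ?h"
  have "(\<integral>\<^sup>+x\<in>Q0. ?h x \<partial>M) = (\<integral>\<^sup>+x\<in>(\<Union>m. Q0 - cover m). ?h x \<partial>M)"
    by (rule nn_integral_cong_AE, use AE_outside_cover in eventually_elim) (auto split: split_indicator)
  also have "\<dots> = emeasure ?N (\<Union>m. Q0 - cover m)" by (subst emeasure_density) auto
  also have "\<dots> = (SUP m. emeasure ?N (Q0 - cover m))"
    using cover_antimono by (intro SUP_emeasure_incseq[symmetric]) (auto simp: incseq_def)
  also have "\<dots> = (SUP m. \<integral>\<^sup>+x\<in>Q0 - cover m. ?h x \<partial>M)" by (simp add: emeasure_density)
  also have "\<dots> \<le> ennreal (4/3 * (2 * s * c) powr s) * K * (\<integral>\<^sup>+x\<in>Q0. u x \<partial>M)"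
    by (intro SUP_least trunc)
  finally show ?thesis .
qed

end

section \<open>Half-open cubes and Calderon--Zygmund decomposition\<close>

text \<open>Half-open cubes, because those of a dyadic grid are genuinely disjoint. They differ from closed
  cubes by null sets.\<close>
definition hcube :: "real ^ 'n \<Rightarrow> real \<Rightarrow> (real ^ 'n) set" where
  "hcube a h = {x. \<forall>i. a $ i \<le> x $ i \<and> x $ i < a $ i + h}"

definition hcubes :: "(real ^ 'n) set set" where
  "hcubes = {hcube a h | a h. 0 < h}"

lemma hcube_subset_cbox: "hcube a h \<subseteq> cbox a (a + (\<chi> i. h))"
  by (auto simp: hcube_def mem_box_cart less_imp_le)

lemma cbox_minus_hcube_null: "cbox a (a + (\<chi> i. h)) - hcube a h \<in> null_sets lebesgue"
proof -
  have "cbox a (a + (\<chi> i. h)) - hcube a h \<subseteq> cbox a (a + (\<chi> i. h)) - box a (a + (\<chi> i. h))"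
    by (auto simp: hcube_def mem_box_cart less_imp_le)
  moreover have "cbox a (a + (\<chi> i. h)) - box a (a + (\<chi> i. h)) \<in> null_sets lebesgue"
    using negligible_frontier_interval negligible_iff_null_sets by blast
  ultimately show ?thesis using negligible_iff_null_sets negligible_subset by blast
qed

lemma hcube_sets[measurable]: "hcube a h \<in> sets lebesgue"
proof -
  have "cbox a (a + (\<chi> i. h)) - (cbox a (a + (\<chi> i. h)) - hcube a h) \<in> sets lebesgue"
    by (rule sets.Diff[OF _ null_setsD2[OF cbox_minus_hcube_null]]) simp
  also have "cbox a (a + (\<chi> i. h)) - (cbox a (a + (\<chi> i. h)) - hcube a h) = hcube a h"
    using hcube_subset_cbox by auto
  finally show ?thesis .
qed

lemma AE_hcube_iff_cbox: "AE x in lebesgue. x \<in> hcube a h \<longleftrightarrow> x \<in> cbox a (a + (\<chi> i. h))"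
  using AE_not_in[OF cbox_minus_hcube_null[of a h]] by eventually_elim (use hcube_subset_cbox in auto)

lemma emeasure_cube:
  assumes "0 < h"
  shows "emeasure lebesgue (cbox a (a + (\<chi> i. h)) :: (real ^ 'n) set) = ennreal (h ^ CARD('n))"
proof -
  have ne: "cbox a (a + (\<chi> i. h)) \<noteq> {}" using assms by (auto simp: interval_ne_empty_cart less_imp_le)
  have "measure lebesgue (cbox a (a + (\<chi> i. h)) :: (real ^ 'n) set) = h ^ CARD('n)"
    using content_cbox_cart[OF ne] by simp
  moreover have "emeasure lebesgue (cbox a (a + (\<chi> i. h)) :: (real ^ 'n) set) \<noteq> top"
    by (rule fmeasurableD2[OF lmeasurable_cbox])
  ultimately show ?thesis by (metis emeasure_eq_ennreal_measure)
qed

lemma emeasure_hcube: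
  assumes "0 < h"
  shows "emeasure lebesgue (hcube a h :: (real ^ 'n) set) = ennreal (h ^ CARD('n))"
proof -
  have "emeasure lebesgue (hcube a h) = emeasure lebesgue (cbox a (a + (\<chi> i. h)))"
    using AE_hcube_iff_cbox by (intro emeasure_eq_AE) auto
  then show ?thesis using emeasure_cube[OF assms] by simp
qed

text \<open>The half-open cube of side \<open>h / 2 ^ m\<close> that contains \<open>x\<close>, in the grid that starts at \<open>a\<close>.\<close>
definition dyadic_cell :: "real ^ 'n \<Rightarrow> real \<Rightarrow> nat \<Rightarrow> real ^ 'n \<Rightarrow> (real ^ 'n) set" where
  "dyadic_cell a h m x = {y. \<forall>i. \<lfloor>(y $ i - a $ i) * 2 ^ m / h\<rfloor> = \<lfloor>(x $ i - a $ i) * 2 ^ m / h\<rfloor>}"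

definition dyadic :: "real ^ 'n \<Rightarrow> real \<Rightarrow> (real ^ 'n) set set" where
  "dyadic a h = {dyadic_cell a h m x | m x. x \<in> hcube a h}"

lemma dyadic_cell_self: "x \<in> dyadic_cell a h m x"
  by (simp add: dyadic_cell_def)

lemma dyadic_cell_eq: "y \<in> dyadic_cell a h m x \<Longrightarrow> dyadic_cell a h m y = dyadic_cell a h m x"
  by (auto simp: dyadic_cell_def)

lemma dyadic_cell_hcube:
  assumes "0 < h"
  shows "dyadic_cell a h m x = hcube (\<chi> i. a $ i + h / 2 ^ m * \<lfloor>(x $ i - a $ i) * 2 ^ m / h\<rfloor>) (h / 2 ^ m)"
proof -
  have "\<lfloor>(y - b) * 2 ^ m / h\<rfloor> = k \<longleftrightarrow> b + h / 2 ^ m * k \<le> y \<and> y < b + h / 2 ^ m * k + h / 2 ^ m"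
    for y b :: real and k :: int
    using assms by (simp add: floor_eq_iff field_simps)
  then show ?thesis by (simp add: dyadic_cell_def hcube_def)
qed

lemma dyadic_cell_0: "0 < h \<Longrightarrow> x \<in> hcube a h \<Longrightarrow> dyadic_cell a h 0 x = hcube a h"
proof -
  assume h: "0 < h" and x: "x \<in> hcube a h"
  have "\<lfloor>(y - b) / h\<rfloor> = 0 \<longleftrightarrow> b \<le> y \<and> y < b + h" for y b :: real
    using h by (simp add: floor_eq_iff field_simps)
  note z = this
  have "\<forall>i. \<lfloor>(x $ i - a $ i) / h\<rfloor> = 0" using x z by (auto simp: hcube_def)
  then have "dyadic_cell a h 0 x = {y. \<forall>i. \<lfloor>(y $ i - a $ i) / h\<rfloor> = 0}"
    unfolding dyadic_cell_def by simp
  also have "\<dots> = hcube a h" unfolding z hcube_def by (rule refl)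
  finally show ?thesis .
qed

lemma floor_double_eq:
  fixes z z' :: real
  assumes "\<lfloor>2 * z\<rfloor> = \<lfloor>2 * z'\<rfloor>"
  shows "\<lfloor>z\<rfloor> = \<lfloor>z'\<rfloor>"
proof -
  have "\<lfloor>z\<rfloor> = \<lfloor>2 * z\<rfloor> div 2" for z :: real
    using floor_divide_real_eq_div[of 2 "2 * z"] by simp
  then show ?thesis using assms by metis
qed

lemma dyadic_cell_Suc: "dyadic_cell a h (Suc m) x \<subseteq> dyadic_cell a h m x"
proof
  fix y assume y: "y \<in> dyadic_cell a h (Suc m) x"
  have dbl: "(z - b) * 2 ^ Suc m / h = 2 * ((z - b) * 2 ^ m / h)" for z b :: real by simp
  have "\<lfloor>(y $ i - a $ i) * 2 ^ m / h\<rfloor> = \<lfloor>(x $ i - a $ i) * 2 ^ m / h\<rfloor>" for i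
    using y unfolding dyadic_cell_def dbl by (intro floor_double_eq[of "(y $ i - a $ i) * 2 ^ m / h"]) simp
  then show "y \<in> dyadic_cell a h m x" unfolding dyadic_cell_def by blast
qed

lemma dyadic_cell_antimono: "m \<le> k \<Longrightarrow> dyadic_cell a h k x \<subseteq> dyadic_cell a h m x"
proof (induction k rule: dec_induct)
  case (step k)
  show ?case using step.IH dyadic_cell_Suc[of a h k x] by (rule subset_trans[rotated])
qed simp

lemma dyadic_cell_subset: "0 < h \<Longrightarrow> x \<in> hcube a h \<Longrightarrow> dyadic_cell a h m x \<subseteq> hcube a h"
  using dyadic_cell_antimono[of 0 m a h x] dyadic_cell_0[of h x a] by simp

lemma dyadic_in_hcubes:
  assumes h: "0 < h"
  shows "dyadic a h \<subseteq> hcubes"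
proof
  fix R assume "R \<in> dyadic a h"
  then obtain m x where "R = dyadic_cell a h m x" unfolding dyadic_def by blast
  moreover have "0 < h / 2 ^ m" using h by simp
  ultimately show "R \<in> hcubes" unfolding hcubes_def dyadic_cell_hcube[OF h] by blast
qed

lemma dyadic_subset: "0 < h \<Longrightarrow> R \<in> dyadic a h \<Longrightarrow> R \<subseteq> hcube a h"
  unfolding dyadic_def using dyadic_cell_subset by blast

lemma interior_hcube_nonempty:
  assumes "0 < h"
  shows "interior (hcube a h) \<noteq> {}"
proof -
  have "box a (a + (\<chi> i. h)) \<subseteq> interior (hcube a h)"
    by (intro interior_maximal) (auto simp: hcube_def mem_box_cart less_imp_le)
  moreover have "a + (\<chi> i. h / 2) \<in> box a (a + (\<chi> i. h))" using assms by (simp add: mem_box_cart)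
  ultimately show ?thesis by auto
qed

lemma dyadic_in_open:
  fixes a :: "real ^ 'n"
  assumes h: "0 < h" and x: "x \<in> hcube a h" "x \<in> U" and U: "open U"
  shows "\<exists>R\<in>dyadic a h. x \<in> R \<and> R \<subseteq> U"
proof -
  obtain e where e: "0 < e" "ball x e \<subseteq> U" using U x openE by blast
  let ?n = "real CARD('n)"
  obtain m where m: "(1/2) ^ m < e / (h * ?n)"
    using real_arch_pow_inv[of "e / (h * ?n)" "1/2"] e h by auto
  have "dyadic_cell a h m x \<subseteq> ball x e"
  proof
    fix y assume y: "y \<in> dyadic_cell a h m x"
    have "\<bar>(x - y) $ i\<bar> \<le> h / 2 ^ m" for i
    proof -
      have "x \<in> dyadic_cell a h m x" by (rule dyadic_cell_self)
      with y show ?thesis unfolding dyadic_cell_hcube[OF h] hcube_def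
        by (auto simp: abs_le_iff dest!: spec[of _ i])
    qed
    then have "norm (x - y) \<le> (\<Sum>i\<in>(UNIV::'n set). h / 2 ^ m)"
      using norm_le_l1_cart[of "x - y"] by (meson order_trans sum_mono)
    also have "\<dots> = ?n * h * (1/2) ^ m" by (simp add: power_divide)
    also have "\<dots> < e" using m h by (simp add: field_simps)
    finally show "y \<in> ball x e" by (simp add: dist_norm)
  qed
  then have "dyadic_cell a h m x \<subseteq> U" using e(2) by (rule subset_trans)
  moreover have "dyadic_cell a h m x \<in> dyadic a h" using x(1) unfolding dyadic_def by blast
  ultimately show ?thesis using dyadic_cell_self[of x a h m] by (intro bexI[of _ "dyadic_cell a h m x"] conjI)
qed

text \<open>The maximal dyadic cubes with a property \<open>\<Phi>\<close>: take the first level at which the cell of \<open>x\<close> has the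
  property. The parent of such a cube fails the property and has \<open>2\<^sup>n\<close> times its measure.\<close>
lemma maximal_dyadic:
  fixes a :: "real ^ 'n"
  assumes h: "0 < h"
  shows "\<exists>C. C \<subseteq> dyadic a h \<and> countable C \<and> disjoint C \<and> (\<forall>R\<in>C. \<Phi> R) \<and>
    (\<forall>R\<in>C. R = hcube a h \<or>
       (\<exists>R'\<in>dyadic a h. R \<subseteq> R' \<and> \<not> \<Phi> R' \<and> emeasure lebesgue R' = ennreal (2 ^ CARD('n)) * emeasure lebesgue R)) \<and>
    (\<forall>R\<in>dyadic a h. \<Phi> R \<longrightarrow> R \<subseteq> \<Union>C)"
proof -
  let ?c = "dyadic_cell a h"
  define l where "l x = (LEAST m. \<Phi> (?c m x))" for x
  define C where "C = {?c (l x) x | x. x \<in> hcube a h \<and> (\<exists>m. \<Phi> (?c m x))}"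
  have l: "\<Phi> (?c (l x) x)" if "\<Phi> (?c m x)" for m x unfolding l_def using that by (rule LeastI)
  have l_le: "l x \<le> m" if "\<Phi> (?c m x)" for m x unfolding l_def using that by (rule Least_le)
  have same: "?c (l x) x = ?c (l y) y"
    if "\<Phi> (?c mx x)" "\<Phi> (?c my y)" "z \<in> ?c (l x) x" "z \<in> ?c (l y) y" "l x \<le> l y" for x y z mx my
  proof -
    have z: "z \<in> ?c (l x) y" using that dyadic_cell_antimono by blast
    then have eq: "?c (l x) y = ?c (l x) x" using dyadic_cell_eq that(3) by metis
    then have "l y \<le> l x" using l_le[of "l x" y] l[OF that(1)] by simp
    then show ?thesis using eq that(5) by simp
  qed
  have 1: "C \<subseteq> dyadic a h" unfolding C_def dyadic_def by auto
  have 3: "disjoint C"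
  proof (rule disjointI)
    fix R R' assume R: "R \<in> C" "R' \<in> C" "R \<noteq> R'"
    obtain x mx where x: "R = ?c (l x) x" "\<Phi> (?c mx x)" using R(1) unfolding C_def by blast
    obtain y my where y: "R' = ?c (l y) y" "\<Phi> (?c my y)" using R(2) unfolding C_def by blast
    show "R \<inter> R' = {}"
    proof (rule ccontr)
      assume "R \<inter> R' \<noteq> {}"
      then obtain z where z: "z \<in> ?c (l x) x" "z \<in> ?c (l y) y" using x y by blast
      consider "l x \<le> l y" | "l y \<le> l x" by linarith
      then have "?c (l x) x = ?c (l y) y"
        using same[OF x(2) y(2) z] same[OF y(2) x(2) z(2,1)] by cases simp_all
      then show False using R x y by simp
    qed
  qed
  have 2: "countable C"
  proof (rule countable_disjoint_nonempty_interior_subsets)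
    show "pairwise disjnt C" using 3 .
    fix S assume "S \<in> C" "interior S = {}"
    then obtain b k where "S = hcube b k" "0 < k" using 1 dyadic_in_hcubes[OF h] unfolding hcubes_def by blast
    then show "S = {}" using interior_hcube_nonempty \<open>interior S = {}\<close> by blast
  qed
  have 4: "\<Phi> R" if "R \<in> C" for R using that l unfolding C_def by auto
  have 5: "R = hcube a h \<or>
       (\<exists>R'\<in>dyadic a h. R \<subseteq> R' \<and> \<not> \<Phi> R' \<and> emeasure lebesgue R' = ennreal (2 ^ CARD('n)) * emeasure lebesgue R)"
    if R: "R \<in> C" for R
  proof -
    obtain x where x: "R = ?c (l x) x" "x \<in> hcube a h" using R unfolding C_def by auto
    show ?thesis
    proof (cases "l x")
      case 0
      then show ?thesis using x dyadic_cell_0[OF h] by auto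
    next
      case (Suc k)
      have "\<not> \<Phi> (?c k x)" using l_le[of k x] Suc by auto
      moreover have "emeasure lebesgue (?c k x) = ennreal (2 ^ CARD('n)) * emeasure lebesgue R"
      proof -
        have pos: "0 < h / 2 ^ k" "0 < h / 2 ^ Suc k" using h by auto
        have "h / 2 ^ k = 2 * (h / 2 ^ Suc k)" by simp
        then have "(h / 2 ^ k) ^ CARD('n) = 2 ^ CARD('n) * (h / 2 ^ Suc k) ^ CARD('n)"
          by (simp only: power_mult_distrib)
        then show ?thesis
          unfolding x Suc dyadic_cell_hcube[OF h] emeasure_hcube[OF pos(1)] emeasure_hcube[OF pos(2)]
          by (simp only: ennreal_mult' zero_le_power zero_le_numeral)
      qed
      moreover have "R \<subseteq> ?c k x" unfolding x Suc by (rule dyadic_cell_Suc)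
      moreover have "?c k x \<in> dyadic a h" using x unfolding dyadic_def by auto
      ultimately show ?thesis by blast
    qed
  qed
  have 6: "R \<subseteq> \<Union>C" if R: "R \<in> dyadic a h" "\<Phi> R" for R
  proof
    fix y assume y: "y \<in> R"
    obtain m x where x: "R = ?c m x" using R unfolding dyadic_def by auto
    then have "R = ?c m y" using y dyadic_cell_eq by blast
    moreover have "y \<in> hcube a h" using y R dyadic_subset[OF h] by blast
    ultimately have "?c (l y) y \<in> C" using R unfolding C_def by blast
    then show "y \<in> \<Union>C" using dyadic_cell_self by blast
  qed
  show ?thesis
    by (intro exI[of _ C] conjI 1 2 3 ballI impI) (erule 4, erule 5, erule 6, assumption)
qed

text \<open>The Calderon--Zygmund cubes are the maximal dyadic cubes on which the average of \<open>g\<close> exceeds \<open>t\<close>.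
  The bound \<open>g \<le> t\<close> outside of them is obtained without Lebesgue's differentiation theorem. Let \<open>E\<close> be
  the set of points outside where \<open>g > t\<close>. The part in \<open>P\<close> of an open set \<open>U \<supseteq> E\<close> is a disjoint union of dyadic
  cubes, and those that meet \<open>E\<close> have averages at most \<open>t\<close>. Hence \<open>\<integral>\<^sub>E g \<le> t |U|\<close>, and \<open>U\<close> may be taken with
  measure close to \<open>|E|\<close>, so \<open>\<integral>\<^sub>E (g - t) = 0\<close>.\<close>
theorem calderon_zygmund:
  fixes P :: "(real ^ 'n) set" and g :: "real ^ 'n \<Rightarrow> ennreal"
  assumes P: "P \<in> hcubes" and [measurable]: "g \<in> borel_measurable lebesgue"
    and t: "0 < t" and le: "(\<integral>\<^sup>+x\<in>P. g x \<partial>lebesgue) \<le> ennreal (t / 4) * emeasure lebesgue P"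
  obtains C where "C \<subseteq> hcubes" "countable C" "disjoint C" "\<And>R. R \<in> C \<Longrightarrow> R \<subseteq> P"
    "emeasure lebesgue (\<Union>C) \<le> ennreal (1/4) * emeasure lebesgue P"
    "\<And>R. R \<in> C \<Longrightarrow> (\<integral>\<^sup>+x\<in>R. g x \<partial>lebesgue) \<le> ennreal (2 ^ CARD('n) * t) * emeasure lebesgue R"
    "AE x in lebesgue. x \<in> P - \<Union>C \<longrightarrow> g x \<le> ennreal t"
proof -
  obtain a h where Ph: "P = hcube a h" and h: "0 < h" using P by (auto simp: hcubes_def)
  have hs: "R \<in> sets lebesgue" if "R \<in> hcubes" for R using that by (auto simp: hcubes_def)
  have Pfin: "emeasure lebesgue P < \<infinity>" "0 < emeasure lebesgue P"
    unfolding Ph emeasure_hcube[OF h] using h by auto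
  have [measurable]: "P \<in> sets lebesgue" using hs P by auto
  define bad where "bad R \<longleftrightarrow> ennreal t * emeasure lebesgue R < (\<integral>\<^sup>+x\<in>R. g x \<partial>lebesgue)" for R
  obtain C where C: "C \<subseteq> dyadic a h" "countable C" "disjoint C" "\<forall>R\<in>C. bad R"
    "\<forall>R\<in>C. R = hcube a h \<or>
       (\<exists>R'\<in>dyadic a h. R \<subseteq> R' \<and> \<not> bad R' \<and> emeasure lebesgue R' = ennreal (2 ^ CARD('n)) * emeasure lebesgue R)"
    "\<forall>R\<in>dyadic a h. bad R \<longrightarrow> R \<subseteq> \<Union>C"
    using maximal_dyadic[OF h, of a bad] by (elim exE conjE)
  have Csets: "C \<subseteq> sets lebesgue" using C(1) dyadic_in_hcubes[OF h, of a] hs by blast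
  have [measurable]: "\<Union>C \<in> sets lebesgue" using Csets C(2) by (auto intro: sets.countable_Union)
  have CP: "R \<subseteq> P" if "R \<in> C" for R using dyadic_subset[OF h] C(1) that Ph by blast
  have Pgood: "\<not> bad P"
  proof -
    have "ennreal (t / 4) * emeasure lebesgue P \<le> ennreal t * emeasure lebesgue P"
      using t by (intro mult_right_mono ennreal_leI) auto
    then show ?thesis unfolding bad_def using le by (meson leD order_trans)
  qed
  have cancel: "ennreal t * x \<le> ennreal t * y \<Longrightarrow> x \<le> y" for x y :: ennreal
    using t by (subst (asm) ennreal_mult_le_mult_iff) auto
  have small: "emeasure lebesgue (\<Union>C) \<le> ennreal (1/4) * emeasure lebesgue P"
  proof (rule cancel)
    have "ennreal t * emeasure lebesgue (\<Union>C) = (\<integral>\<^sup>+x\<in>\<Union>C. ennreal t \<partial>lebesgue)"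
      by (simp add: nn_integral_cmult_indicator)
    also have "\<dots> \<le> (\<integral>\<^sup>+x\<in>\<Union>C. g x \<partial>lebesgue)"
    proof (rule nn_integral_Union_mono[OF C(2,3) Csets])
      fix R assume R: "R \<in> C"
      then have "R \<in> sets lebesgue" using Csets by auto
      then show "(\<integral>\<^sup>+x\<in>R. ennreal t \<partial>lebesgue) \<le> (\<integral>\<^sup>+x\<in>R. g x \<partial>lebesgue)"
        using bspec[OF C(4) R] by (simp add: nn_integral_cmult_indicator bad_def)
    qed auto
    also have "\<dots> \<le> (\<integral>\<^sup>+x\<in>P. g x \<partial>lebesgue)"
      using CP by (intro nn_set_integral_set_mono) auto
    also have "\<dots> \<le> ennreal (t / 4) * emeasure lebesgue P" by (rule le)
    also have "\<dots> = ennreal t * (ennreal (1/4) * emeasure lebesgue P)"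
      using t by (simp add: mult.assoc[symmetric] ennreal_mult[symmetric])
    finally show "ennreal t * emeasure lebesgue (\<Union>C) \<le> ennreal t * (ennreal (1/4) * emeasure lebesgue P)" .
  qed
  have avg: "(\<integral>\<^sup>+x\<in>R. g x \<partial>lebesgue) \<le> ennreal (2 ^ CARD('n) * t) * emeasure lebesgue R" if R: "R \<in> C" for R
  proof -
    have "R \<noteq> hcube a h" using bspec[OF C(4) R] Pgood Ph by auto
    then obtain R' where R': "R \<subseteq> R'" "\<not> bad R'" "emeasure lebesgue R' = ennreal (2 ^ CARD('n)) * emeasure lebesgue R"
      using bspec[OF C(5) R] by blast
    have "(\<integral>\<^sup>+x\<in>R. g x \<partial>lebesgue) \<le> (\<integral>\<^sup>+x\<in>R'. g x \<partial>lebesgue)"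
      using R' by (intro nn_set_integral_set_mono) auto
    also have "\<dots> \<le> ennreal t * emeasure lebesgue R'" using R'(2) by (simp add: bad_def not_less)
    also have "\<dots> = ennreal (2 ^ CARD('n) * t) * emeasure lebesgue R"
      unfolding R'(3) using t by (simp add: ennreal_mult mult_ac)
    finally show ?thesis .
  qed
  define E where "E = {x \<in> P - \<Union>C. ennreal t < g x}"
  have [measurable]: "E \<in> sets lebesgue"
  proof -
    have "E = (P - \<Union>C) \<inter> {x \<in> space lebesgue. ennreal t < g x}" by (auto simp: E_def)
    then show ?thesis by simp
  qed
  have Efin: "emeasure lebesgue E < \<infinity>"
  proof (rule order_le_less_trans[OF _ Pfin(1)])
    show "emeasure lebesgue E \<le> emeasure lebesgue P" by (rule emeasure_mono) (auto simp: E_def)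
  qed
  have E_le: "(\<integral>\<^sup>+x\<in>E. g x \<partial>lebesgue) \<le> ennreal t * emeasure lebesgue E + ennreal e" if e: "0 < e" for e
  proof -
    obtain U where U: "open U" "E \<subseteq> U" "(U - E) \<in> lmeasurable" "emeasure lebesgue (U - E) < ennreal (e / t)"
      using sets_lebesgue_outer_open[of E "e / t"] e t by auto
    obtain D where D: "D \<subseteq> dyadic a h" "countable D" "disjoint D" "\<forall>R\<in>D. R \<subseteq> U"
      "\<forall>R\<in>dyadic a h. R \<subseteq> U \<longrightarrow> R \<subseteq> \<Union>D"
      using maximal_dyadic[OF h, of a "\<lambda>R. R \<subseteq> U"] by (elim exE conjE)
    define D' where "D' = {R \<in> D. R \<inter> E \<noteq> {}}"
    have D's: "D' \<subseteq> sets lebesgue" "countable D'" "disjoint D'"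
      using D(1) dyadic_in_hcubes[OF h, of a] hs D(2,3)
      by (auto simp: D'_def intro: pairwise_subset countable_subset)
    have [measurable]: "\<Union>D' \<in> sets lebesgue" using D's by (auto intro: sets.countable_Union)
    have [measurable]: "U \<in> sets lebesgue" using U(1) by auto
    have ED: "E \<subseteq> \<Union>D'"
    proof
      fix x assume x: "x \<in> E"
      then have "x \<in> hcube a h" "x \<in> U" using U Ph by (auto simp: E_def)
      then obtain R where "R \<in> dyadic a h" "x \<in> R" "R \<subseteq> U" using dyadic_in_open[OF h _ _ U(1)] by blast
      then show "x \<in> \<Union>D'" using D(5) x unfolding D'_def by blast
    qed
    have "(\<integral>\<^sup>+x\<in>E. g x \<partial>lebesgue) \<le> (\<integral>\<^sup>+x\<in>\<Union>D'. g x \<partial>lebesgue)"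
      using ED by (intro nn_set_integral_set_mono) auto
    also have "\<dots> \<le> (\<integral>\<^sup>+x\<in>\<Union>D'. ennreal t \<partial>lebesgue)"
    proof (rule nn_integral_Union_mono[OF D's(2,3,1)])
      fix R assume R: "R \<in> D'"
      then have "R \<in> sets lebesgue" using D's by auto
      have "\<not> bad R"
      proof
        assume "bad R"
        then have "R \<subseteq> \<Union>C" using C(6) R D(1) by (auto simp: D'_def)
        then show False using R unfolding D'_def E_def by blast
      qed
      then show "(\<integral>\<^sup>+x\<in>R. g x \<partial>lebesgue) \<le> (\<integral>\<^sup>+x\<in>R. ennreal t \<partial>lebesgue)"
        using \<open>R \<in> sets lebesgue\<close> by (simp add: nn_integral_cmult_indicator bad_def not_less)
    qed auto
    also have "\<dots> = ennreal t * emeasure lebesgue (\<Union>D')" by (simp add: nn_integral_cmult_indicator)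
    also have "\<dots> \<le> ennreal t * emeasure lebesgue (E \<union> (U - E))"
      using D(4) by (intro mult_left_mono emeasure_mono) (auto simp: D'_def)
    also have "\<dots> = ennreal t * (emeasure lebesgue E + emeasure lebesgue (U - E))"
      by (subst plus_emeasure) auto
    also have "\<dots> \<le> ennreal t * (emeasure lebesgue E + ennreal (e / t))"
      using U(4) by (intro mult_left_mono add_left_mono) auto
    also have "\<dots> = ennreal t * emeasure lebesgue E + ennreal e"
      using t e by (simp add: distrib_left ennreal_mult[symmetric])
    finally show ?thesis .
  qed
  have "(\<integral>\<^sup>+x\<in>E. g x \<partial>lebesgue) \<le> ennreal t * emeasure lebesgue E"
  proof (rule ennreal_le_epsilon)
    fix e :: real assume "0 < e"
    then show "(\<integral>\<^sup>+x\<in>E. g x \<partial>lebesgue) \<le> ennreal t * emeasure lebesgue E + ennreal e" by (rule E_le)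
  qed
  moreover have "(\<integral>\<^sup>+x\<in>E. g x \<partial>lebesgue) = (\<integral>\<^sup>+x\<in>E. (g x - ennreal t) \<partial>lebesgue) + ennreal t * emeasure lebesgue E"
  proof -
    have "(\<integral>\<^sup>+x\<in>E. g x \<partial>lebesgue)
      = (\<integral>\<^sup>+x. (g x - ennreal t) * indicator E x + ennreal t * indicator E x \<partial>lebesgue)"
      by (intro nn_integral_cong) (auto simp: E_def diff_add_cancel_ennreal less_imp_le split: split_indicator)
    also have "\<dots> = (\<integral>\<^sup>+x\<in>E. (g x - ennreal t) \<partial>lebesgue) + ennreal t * emeasure lebesgue E"
      by (subst nn_integral_add) (auto simp: nn_integral_cmult_indicator)
    finally show ?thesis .
  qed
  moreover have "ennreal t * emeasure lebesgue E < \<infinity>" using Efin by (auto simp: ennreal_mult_less_top)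
  ultimately have "(\<integral>\<^sup>+x\<in>E. (g x - ennreal t) \<partial>lebesgue) + ennreal t * emeasure lebesgue E
      \<le> 0 + ennreal t * emeasure lebesgue E" and "ennreal t * emeasure lebesgue E \<noteq> top"
    by auto
  then have "(\<integral>\<^sup>+x\<in>E. (g x - ennreal t) \<partial>lebesgue) = 0"
    using ennreal_add_left_cancel_le[of "ennreal t * emeasure lebesgue E" _ 0] by (simp add: add.commute)
  then have "AE x in lebesgue. (g x - ennreal t) * indicator E x = 0"
    by (subst (asm) nn_integral_0_iff_AE) auto
  then have ae: "AE x in lebesgue. x \<in> P - \<Union>C \<longrightarrow> g x \<le> ennreal t"
  proof eventually_elim
    case (elim x)
    show ?case
    proof (rule impI, rule ccontr)
      assume "x \<in> P - \<Union>C" "\<not> g x \<le> ennreal t"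
      then have "x \<in> E" by (simp add: E_def not_le)
      then have "g x - ennreal t = 0" using elim by simp
      then show False using \<open>\<not> g x \<le> ennreal t\<close> diff_gt_0_iff_gt_ennreal[of "g x" "ennreal t"] by (simp add: not_le)
    qed
  qed
  have Ch: "C \<subseteq> hcubes" using C(1) dyadic_in_hcubes[OF h] by (rule subset_trans)
  show thesis by (rule that[OF Ch C(2,3) CP small avg ae])
qed

section \<open>The oscillation estimate for weights\<close>

lemma locally_integrable_measurable:
  fixes f :: "real ^ 'n \<Rightarrow> real"
  assumes "locally_integrable f"
  shows "f \<in> borel_measurable lebesgue"
proof (rule borel_measurable_LIMSEQ_real)
  fix k :: nat
  have "set_integrable lebesgue (cball 0 (real k)) f"
    using assms by (simp add: locally_integrable_def)
  then show "(\<lambda>x. indicator (cball 0 (real k)) x *\<^sub>R f x) \<in> borel_measurable lebesgue"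
    unfolding set_integrable_def by (rule borel_measurable_integrable)
next
  fix x :: "real ^ 'n"
  obtain N :: nat where N: "norm x \<le> real N" using real_arch_simple by blast
  have "\<forall>\<^sub>F k in sequentially. f x = indicator (cball 0 (real k)) x *\<^sub>R f x"
    using N by (intro eventually_sequentiallyI[of N]) auto
  then show "(\<lambda>k. indicator (cball 0 (real k)) x *\<^sub>R f x) \<longlonglongrightarrow> f x"
    by (rule Lim_transform_eventually[OF tendsto_const])
qed

lemma locally_integrable_hcube:
  assumes "locally_integrable f" "P \<in> hcubes"
  shows "set_integrable lebesgue P f"
proof -
  obtain a h where P: "P = hcube a h" using assms by (auto simp: hcubes_def)
  have "set_integrable lebesgue (cbox a (a + (\<chi> i. h))) f"
    using assms(1) by (simp add: locally_integrable_def)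
  then show ?thesis unfolding P by (rule set_integrable_subset[OF _ hcube_sets hcube_subset_cbox])
qed

lemma set_nn_integral_hcube:
  "(\<integral>\<^sup>+x\<in>hcube a h. f x \<partial>lebesgue) = (\<integral>\<^sup>+x\<in>cbox a (a + (\<chi> i. h)). f x \<partial>lebesgue)"
  by (rule nn_integral_cong_AE, use AE_hcube_iff_cbox[of a h] in eventually_elim) (simp add: indicator_def)

lemma wmass_hcube: "wmass w (hcube a h) = wmass w (cbox a (a + (\<chi> i. h)))"
  unfolding wmass_def by (rule set_nn_integral_hcube)

lemma emeasure_hcube_cbox: "emeasure lebesgue (hcube a h) = emeasure lebesgue (cbox a (a + (\<chi> i. h)))"
  using AE_hcube_iff_cbox by (rule emeasure_eq_AE) auto

lemma mean_hcube:
  assumes "locally_integrable f"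
  shows "mean f (hcube a h) = mean f (cbox a (a + (\<chi> i. h)))"
proof -
  have [measurable]: "f \<in> borel_measurable lebesgue" using assms by (rule locally_integrable_measurable)
  have [measurable]: "cbox a (a + (\<chi> i. h)) \<in> sets lebesgue" by simp
  have "(LINT x:hcube a h|lebesgue. f x) = (LINT x:cbox a (a + (\<chi> i. h))|lebesgue. f x)"
    unfolding set_lebesgue_integral_def
  proof (rule integral_cong_AE)
    show "AE x in lebesgue. indicator (hcube a h) x *\<^sub>R f x = indicator (cbox a (a + (\<chi> i. h))) x *\<^sub>R f x"
      using AE_hcube_iff_cbox[of a h] by eventually_elim (simp add: indicator_def)
  qed auto
  then show ?thesis unfolding mean_def measure_def emeasure_hcube_cbox by simp
qed

lemma hcube_emeasure_pos: "P \<in> hcubes \<Longrightarrow> 0 < emeasure lebesgue P \<and> emeasure lebesgue P < \<infinity>"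
  unfolding hcubes_def by (auto simp only: mem_Collect_eq) (simp_all only: emeasure_hcube, auto)

lemma hcubes_sets: "P \<in> hcubes \<Longrightarrow> P \<in> sets lebesgue"
  by (auto simp: hcubes_def)

lemma hcubes_cube: "P \<in> hcubes \<Longrightarrow> \<exists>a h. 0 < h \<and> P = hcube a h \<and> cbox a (a + (\<chi> i. h)) \<in> cubes"
  unfolding hcubes_def cubes_def by blast

lemma cubes_hcube: "Q \<in> cubes \<Longrightarrow> \<exists>a h. 0 < h \<and> Q = cbox a (a + (\<chi> i. h)) \<and> hcube a h \<in> hcubes"
  unfolding hcubes_def cubes_def by blast

lemma wmass_eq_mean:
  assumes w: "weight w" and P: "P \<in> hcubes"
  shows "wmass w P = ennreal (mean w P) * emeasure lebesgue P"
proof -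
  have int: "set_integrable lebesgue P w" using w P by (auto simp: weight_def intro: locally_integrable_hcube)
  have fin: "emeasure lebesgue P \<noteq> top" and pos: "0 < emeasure lebesgue P" using hcube_emeasure_pos[OF P] by auto
  have em: "emeasure lebesgue P = ennreal (measure lebesgue P)" using fin by (rule emeasure_eq_ennreal_measure)
  have mpos: "0 < measure lebesgue P" using pos unfolding em by simp
  have w0: "0 \<le> w x" for x using w by (simp add: weight_def)
  have "wmass w P = (\<integral>\<^sup>+x. ennreal (indicator P x *\<^sub>R w x) \<partial>lebesgue)"
    unfolding wmass_def by (intro nn_integral_cong) (auto split: split_indicator)
  also have "\<dots> = ennreal (LINT x:P|lebesgue. w x)"
    unfolding set_lebesgue_integral_def using int w0
    by (intro nn_integral_eq_integral) (auto simp: set_integrable_def)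
  also have "(LINT x:P|lebesgue. w x) = mean w P * measure lebesgue P"
    using mpos by (simp add: mean_def)
  also have "ennreal \<dots> = ennreal (mean w P) * ennreal (measure lebesgue P)"
    by (rule ennreal_mult'') simp
  finally show ?thesis unfolding em .
qed

lemma mean_nonneg:
  assumes "weight w"
  shows "0 \<le> mean w P"
  unfolding mean_def set_lebesgue_integral_def
  using assms by (intro divide_nonneg_nonneg integral_nonneg) (auto simp: weight_def split: split_indicator)

lemma mean_pos:
  assumes w: "weight w" and pos: "AE x in lebesgue. 0 < w x" and P: "P \<in> hcubes"
  shows "0 < mean w P"
proof (rule ccontr)
  assume "\<not> 0 < mean w P"
  then have "wmass w P = 0" using wmass_eq_mean[OF w P] mean_nonneg[OF w, of P] by (simp add: ennreal_eq_0_iff)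
  moreover have [measurable]: "w \<in> borel_measurable lebesgue" "P \<in> sets lebesgue"
    using w P by (auto simp: weight_def locally_integrable_measurable hcubes_sets)
  ultimately have "AE x in lebesgue. ennreal (w x) * indicator P x = 0"
    unfolding wmass_def by (subst (asm) nn_integral_0_iff_AE) auto
  then have "AE x in lebesgue. x \<notin> P"
    using pos by eventually_elim (auto split: split_indicator_asm)
  then have "emeasure lebesgue P = 0" using hcubes_sets[OF P]
    by (subst (asm) AE_iff_measurable[of P]) auto
  then show False using hcube_emeasure_pos[OF P] by simp
qed

lemma mean_diff_le:
  assumes f: "locally_integrable f" and R: "R \<in> hcubes"
    and le: "(\<integral>\<^sup>+x\<in>R. ennreal \<bar>f x - m\<bar> \<partial>lebesgue) \<le> ennreal t * emeasure lebesgue R" and t: "0 \<le> t"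
  shows "\<bar>mean f R - m\<bar> \<le> t"
proof -
  have fin: "emeasure lebesgue R \<noteq> top" and pos: "0 < emeasure lebesgue R" using hcube_emeasure_pos[OF R] by auto
  have em: "emeasure lebesgue R = ennreal (measure lebesgue R)" using fin by (rule emeasure_eq_ennreal_measure)
  have mpos: "0 < measure lebesgue R" using pos unfolding em by simp
  have Rs: "R \<in> sets lebesgue" using R by (rule hcubes_sets)
  have int: "set_integrable lebesgue R f" using f R by (rule locally_integrable_hcube)
  have intm: "set_integrable lebesgue R (\<lambda>_. m)"
    unfolding set_integrable_def using Rs fin by (intro integrable_scaleR_left) (simp_all add: less_top del: emeasure_completion)
  have "(LINT x:R|lebesgue. f x - m) = (LINT x:R|lebesgue. f x) - measure lebesgue R * m"
  proof -
    have "(LINT x:R|lebesgue. m) = measure lebesgue R * m"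
      unfolding set_lebesgue_integral_def using Rs fin
      by (subst integral_scaleR_left) (simp_all add: less_top del: emeasure_completion)
    then show ?thesis using set_integral_diff(2)[OF int intm] by simp
  qed
  then have eq: "mean f R - m = (LINT x:R|lebesgue. f x - m) / measure lebesgue R"
    using mpos by (simp add: mean_def field_simps)
  have "ennreal (norm (LINT x:R|lebesgue. f x - m)) \<le> (\<integral>\<^sup>+x. ennreal (norm (indicator R x *\<^sub>R (f x - m))) \<partial>lebesgue)"
    unfolding set_lebesgue_integral_def
    using set_integral_diff(1)[OF int intm] unfolding set_integrable_def by (rule integral_norm_bound_ennreal)
  also have "\<dots> = (\<integral>\<^sup>+x\<in>R. ennreal \<bar>f x - m\<bar> \<partial>lebesgue)"
    by (intro nn_integral_cong) (auto split: split_indicator)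
  also have "\<dots> \<le> ennreal (t * measure lebesgue R)" using le unfolding em using t by (simp add: ennreal_mult)
  finally have "\<bar>LINT x:R|lebesgue. f x - m\<bar> \<le> t * measure lebesgue R"
    using t by (subst (asm) ennreal_le_iff) auto
  then show ?thesis unfolding eq using mpos by (simp add: field_simps)
qed

text \<open>The Calderon--Zygmund cubes of \<open>|b - b\<^sub>P|\<close> at height \<open>4 B \<alpha>(P)\<close>, where \<open>\<alpha>(P) = mean w P\<close>: four
  times the bound for the average over \<open>P\<close> that BMO gives, so that they fill at most a quarter of \<open>P\<close>.
  The factor \<open>2\<^sup>n\<close> in the jump of the mean comes from the passage to the parent cube.\<close>
lemma stopping_cubes:
  fixes w b :: "real ^ 'n \<Rightarrow> real"
  assumes w: "weight w" "AE x in lebesgue. 0 < w x" and b: "locally_integrable b" and B: "0 < B"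
    and bmo: "\<And>Q. Q \<in> cubes \<Longrightarrow> (\<integral>\<^sup>+x\<in>Q. ennreal \<bar>b x - mean b Q\<bar> \<partial>lebesgue) \<le> ennreal B * wmass w Q"
    and P: "P \<in> hcubes"
  shows "\<exists>C. C \<subseteq> hcubes \<and> countable C \<and> disjoint C \<and> (\<forall>R\<in>C. R \<subseteq> P) \<and>
    emeasure lebesgue (\<Union>C) \<le> ennreal (1/4) * emeasure lebesgue P \<and>
    (\<forall>R\<in>C. \<bar>mean b R - mean b P\<bar> \<le> (4 * 2 ^ CARD('n) * B) * mean w P) \<and>
    (AE x in lebesgue. x \<in> P - \<Union>C \<longrightarrow> \<bar>b x - mean b P\<bar> \<le> (4 * 2 ^ CARD('n) * B) * mean w P)"
proof -
  define t where "t = 4 * B * mean w P"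
  have [measurable]: "b \<in> borel_measurable lebesgue" using b by (rule locally_integrable_measurable)
  have t: "0 < t" unfolding t_def using B mean_pos[OF w P] by simp
  obtain a h where Ph: "P = hcube a h" "cbox a (a + (\<chi> i. h)) \<in> cubes" using hcubes_cube[OF P] by blast
  let ?g = "\<lambda>x. ennreal \<bar>b x - mean b P\<bar>"
  have "(\<integral>\<^sup>+x\<in>P. ?g x \<partial>lebesgue) \<le> ennreal B * wmass w P"
    using bmo[OF Ph(2)] unfolding Ph(1) set_nn_integral_hcube mean_hcube[OF b] wmass_hcube .
  also have "\<dots> = ennreal (t / 4) * emeasure lebesgue P"
    unfolding wmass_eq_mean[OF w(1) P] t_def using B mean_nonneg[OF w(1), of P]
    by (simp add: ennreal_mult mult.assoc)
  finally have le: "(\<integral>\<^sup>+x\<in>P. ?g x \<partial>lebesgue) \<le> ennreal (t / 4) * emeasure lebesgue P" .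
  obtain C where C: "C \<subseteq> hcubes" "countable C" "disjoint C" "\<And>R. R \<in> C \<Longrightarrow> R \<subseteq> P"
    "emeasure lebesgue (\<Union>C) \<le> ennreal (1/4) * emeasure lebesgue P"
    "\<And>R. R \<in> C \<Longrightarrow> (\<integral>\<^sup>+x\<in>R. ?g x \<partial>lebesgue) \<le> ennreal (2 ^ CARD('n) * t) * emeasure lebesgue R"
    "AE x in lebesgue. x \<in> P - \<Union>C \<longrightarrow> ?g x \<le> ennreal t"
    by (rule calderon_zygmund[OF P _ t le]) (simp, rule that)
  have c: "(4 * 2 ^ CARD('n) * B) * mean w P = 2 ^ CARD('n) * t" by (simp add: t_def)
  have jump: "\<bar>mean b R - mean b P\<bar> \<le> 2 ^ CARD('n) * t" if R: "R \<in> C" for R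
    using C(6)[OF R] t by (intro mean_diff_le[OF b subsetD[OF C(1) R]]) auto
  have t2: "t \<le> 2 ^ CARD('n) * t" using t by simp
  have ae: "AE x in lebesgue. x \<in> P - \<Union>C \<longrightarrow> \<bar>b x - mean b P\<bar> \<le> 2 ^ CARD('n) * t"
    using C(7)
  proof eventually_elim
    case (elim x)
    show ?case
    proof
      assume "x \<in> P - \<Union>C"
      then have "ennreal \<bar>b x - mean b P\<bar> \<le> ennreal t" using elim by blast
      then have "\<bar>b x - mean b P\<bar> \<le> t" using t by (subst (asm) ennreal_le_iff) auto
      then show "\<bar>b x - mean b P\<bar> \<le> 2 ^ CARD('n) * t" using t2 by linarith
    qed
  qed
  show ?thesis unfolding c
    by (intro exI[of _ C] conjI ballI C(1,2,3,5) ae) (erule C(4), erule jump)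
qed

text \<open>The closure of \<open>P\<close> need not lie in \<open>Q\<close>, but it contains \<open>x\<close> and differs from \<open>P\<close> by a null set.\<close>
lemma mean_le_maximal:
  assumes w: "weight w" and P: "P \<in> hcubes" "P \<subseteq> Q" "x \<in> P"
  shows "ennreal (mean w P) \<le> maximal (\<lambda>y. w y * indicator Q y) x"
proof -
  obtain a h where Ph: "P = hcube a h" "cbox a (a + (\<chi> i. h)) \<in> cubes" using hcubes_cube[OF P(1)] by blast
  let ?R = "cbox a (a + (\<chi> i. h))"
  have xR: "x \<in> ?R" using P(3) hcube_subset_cbox unfolding Ph(1) by blast
  have w0: "0 \<le> w x" for x using w by (simp add: weight_def)
  have fin: "emeasure lebesgue P \<noteq> top" "emeasure lebesgue P \<noteq> 0" using hcube_emeasure_pos[OF P(1)] by auto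
  have "ennreal (mean w P) = wmass w P / emeasure lebesgue P"
    unfolding wmass_eq_mean[OF w P(1)] using fin by (simp add: ennreal_mult_divide_eq del: emeasure_completion)
  also have "\<dots> = (\<integral>\<^sup>+y\<in>P. ennreal \<bar>w y * indicator Q y\<bar> \<partial>lebesgue) / emeasure lebesgue P"
    unfolding wmass_def using P(2) w0
    by (intro arg_cong[where f="\<lambda>z. z / emeasure lebesgue P"] nn_integral_cong) (auto split: split_indicator)
  also have "\<dots> = nn_avg ?R (\<lambda>y. ennreal \<bar>w y * indicator Q y\<bar>)"
    unfolding nn_avg_def Ph(1) set_nn_integral_hcube emeasure_hcube_cbox ..
  also have "\<dots> \<le> maximal (\<lambda>y. w y * indicator Q y) x"
    unfolding maximal_def using Ph(2) xR by (intro SUP_upper) auto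
  finally show ?thesis .
qed

text \<open>The stopping tree of the cubes from \<open>stopping_cubes\<close> with root \<open>Q\<close> (half-open), applied with
  \<open>\<alpha> = mean w\<close>, \<open>\<sigma> = w\<^sup>1\<^sup>-\<^sup>s\<close> and \<open>u = M(w \<chi>\<^sub>Q)\<close>.\<close>
theorem weighted_oscillation_estimate:
  fixes w b :: "real ^ 'n \<Rightarrow> real"
  assumes w: "weight w" "AE x in lebesgue. 0 < w x" and b: "locally_integrable b" and B: "0 < B"
    and bmo: "\<And>Q. Q \<in> cubes \<Longrightarrow> (\<integral>\<^sup>+x\<in>Q. ennreal \<bar>b x - mean b Q\<bar> \<partial>lebesgue) \<le> ennreal B * wmass w Q"
    and s: "1 < s"
    and key: "\<And>Q. Q \<in> cubes \<Longrightarrow> ennreal (mean w Q powr (s - 1)) * (\<integral>\<^sup>+x\<in>Q. ennreal (w x powr (1 - s)) \<partial>lebesgue)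
      \<le> K * emeasure lebesgue Q"
    and Q: "Q \<in> cubes"
  shows "weighted_avg w Q (\<lambda>x. ennreal (\<bar>(b x - mean b Q) / w x\<bar> powr s))
    \<le> ennreal (4/3 * (2 * s * (4 * 2 ^ CARD('n) * B)) powr s) * K * Ainf_const w"
proof -
  let ?c = "4 * 2 ^ CARD('n) * B"
  have [measurable]: "b \<in> borel_measurable lebesgue" "w \<in> borel_measurable lebesgue"
    using b w by (auto simp: weight_def intro: locally_integrable_measurable)
  have lw: "locally_integrable w" using w by (simp add: weight_def)
  define good where "good P C \<longleftrightarrow> C \<subseteq> hcubes \<and> countable C \<and> disjoint C \<and> (\<forall>R\<in>C. R \<subseteq> P) \<and>
    emeasure lebesgue (\<Union>C) \<le> ennreal (1/4) * emeasure lebesgue P \<and>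
    (\<forall>R\<in>C. \<bar>mean b R - mean b P\<bar> \<le> ?c * mean w P) \<and>
    (AE x in lebesgue. x \<in> P - \<Union>C \<longrightarrow> \<bar>b x - mean b P\<bar> \<le> ?c * mean w P)" for P C
  have "\<forall>P\<in>hcubes. \<exists>C. good P C"
    unfolding good_def by (rule ballI, rule stopping_cubes[OF w b B bmo])
  then obtain stop where "\<forall>P\<in>hcubes. good P (stop P)" using bchoice by metis
  note stop = this[unfolded good_def]
  obtain a h where Qh: "0 < h" "Q = cbox a (a + (\<chi> i. h))" "hcube a h \<in> hcubes" using cubes_hcube[OF Q] by blast
  let ?P = "hcube a h"
  have PQ: "?P \<subseteq> Q" unfolding Qh(2) by (rule hcube_subset_cbox)
  interpret stopping_tree lebesgue hcubes stop ?P
  proof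
    show "emeasure lebesgue P < \<infinity>" if "P \<in> hcubes" for P :: "(real ^ 'n) set"
      using hcube_emeasure_pos[OF that] by (rule conjunct2)
  qed (use stop hcubes_sets Qh(3) in \<open>simp_all del: emeasure_completion\<close>)
  have meanP: "mean b ?P = mean b Q" unfolding Qh(2) by (rule mean_hcube[OF b])
  have est: "(\<integral>\<^sup>+x\<in>?P. ennreal (\<bar>b x - mean b ?P\<bar> powr s) * ennreal (w x powr (1 - s)) \<partial>lebesgue)
    \<le> ennreal (4/3 * (2 * s * ?c) powr s) * K * (\<integral>\<^sup>+x\<in>?P. maximal (\<lambda>y. w y * indicator Q y) x \<partial>lebesgue)"
  proof (rule oscillation_power_integral_le[where \<alpha>="mean w"])
    show "1 < s" by (rule s)
    show "0 \<le> ?c" using B by simp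
    show "0 \<le> mean w P" for P using w(1) by (rule mean_nonneg)
    show "(\<lambda>x. ennreal (w x powr (1 - s))) \<in> borel_measurable lebesgue" by simp
    show "b \<in> borel_measurable lebesgue" by simp
    show "ennreal (mean w P powr (s - 1)) * (\<integral>\<^sup>+x\<in>P. ennreal (w x powr (1 - s)) \<partial>lebesgue) \<le> K * emeasure lebesgue P"
      if P: "P \<in> hcubes" for P
    proof -
      obtain a' h' where P': "P = hcube a' h'" "cbox a' (a' + (\<chi> i. h')) \<in> cubes" using hcubes_cube[OF P] by blast
      show ?thesis using key[OF P'(2)]
        unfolding P'(1) mean_hcube[OF lw] set_nn_integral_hcube emeasure_hcube_cbox .
    qed
    show "\<bar>mean b R - mean b P\<bar> \<le> ?c * mean w P" if "P \<in> hcubes" "R \<in> stop P" for P R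
      using stop that by blast
    show "AE x in lebesgue. x \<in> P - \<Union>(stop P) \<longrightarrow> \<bar>b x - mean b P\<bar> \<le> ?c * mean w P" if "P \<in> hcubes" for P
      using bspec[OF stop that] by (elim conjE)
    show "ennreal (mean w P) \<le> maximal (\<lambda>y. w y * indicator Q y) x" if "P \<in> hcubes" "P \<subseteq> ?P" "x \<in> P" for P x
      using that PQ by (intro mean_le_maximal[OF w(1)]) auto
  qed
  have wm: "wmass w Q = ennreal (mean w ?P) * emeasure lebesgue ?P"
    unfolding Qh(2) wmass_hcube[symmetric] by (rule wmass_eq_mean[OF w(1) Qh(3)])
  have m0: "0 < mean w ?P" by (rule mean_pos[OF w Qh(3)])
  have wm0: "wmass w Q \<noteq> 0" "wmass w Q \<noteq> top" 
    unfolding wm using m0 hcube_emeasure_pos[OF Qh(3)]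
    by (auto simp: ennreal_mult_eq_top_iff simp del: emeasure_completion)
  have "(\<integral>\<^sup>+x\<in>?P. maximal (\<lambda>y. w y * indicator Q y) x \<partial>lebesgue) \<le> (\<integral>\<^sup>+x\<in>Q. maximal (\<lambda>y. w y * indicator Q y) x \<partial>lebesgue)"
    using PQ by (rule nn_set_integral_set_mono)
  also have "\<dots> = (\<integral>\<^sup>+x\<in>Q. maximal (\<lambda>y. w y * indicator Q y) x \<partial>lebesgue) / wmass w Q * wmass w Q"
    using wm0 by (simp add: ennreal_divide_times ennreal_divide_self less_top)
  also have "\<dots> \<le> Ainf_const w * wmass w Q"
    unfolding Ainf_const_def by (intro mult_right_mono SUP_upper Q) auto
  finally have max: "(\<integral>\<^sup>+x\<in>?P. maximal (\<lambda>y. w y * indicator Q y) x \<partial>lebesgue) \<le> Ainf_const w * wmass w Q" .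
  have "(\<integral>\<^sup>+x\<in>Q. ennreal (\<bar>(b x - mean b Q) / w x\<bar> powr s) * ennreal (w x) \<partial>lebesgue)
     = (\<integral>\<^sup>+x\<in>?P. ennreal (\<bar>b x - mean b ?P\<bar> powr s) * ennreal (w x powr (1 - s)) \<partial>lebesgue)"
    unfolding meanP Qh(2) set_nn_integral_hcube
  proof (rule nn_integral_cong_AE, use w(2) in eventually_elim)
    fix x assume wx: "0 < w x"
    let ?m = "mean b (cbox a (a + (\<chi> i. h)))"
    have "\<bar>(b x - ?m) / w x\<bar> powr s * w x = \<bar>b x - ?m\<bar> powr s * w x powr (1 - s)"
      using wx by (simp add: powr_divide powr_diff)
    then show "ennreal (\<bar>(b x - ?m) / w x\<bar> powr s) * ennreal (w x) * indicator (cbox a (a + (\<chi> i. h))) x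
      = ennreal (\<bar>b x - ?m\<bar> powr s) * ennreal (w x powr (1 - s)) * indicator (cbox a (a + (\<chi> i. h))) x"
      using wx by (simp add: ennreal_mult[symmetric])
  qed
  also have "\<dots> \<le> ennreal (4/3 * (2 * s * ?c) powr s) * K * (Ainf_const w * wmass w Q)"
    by (rule order_trans[OF est mult_left_mono[OF max]]) simp
  finally have "weighted_avg w Q (\<lambda>x. ennreal (\<bar>(b x - mean b Q) / w x\<bar> powr s))
     \<le> (ennreal (4/3 * (2 * s * ?c) powr s) * K * Ainf_const w * wmass w Q) / wmass w Q"
    unfolding weighted_avg_def by (intro divide_right_mono_ennreal) (simp add: mult.assoc)
  also have "\<dots> = ennreal (4/3 * (2 * s * ?c) powr s) * K * Ainf_const w"
    using wm0 by (simp add: ennreal_mult_divide_eq)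
  finally show ?thesis .
qed

section \<open>Real powers on the extended half-line\<close>

lemma enn_powr_ennreal: "0 < a \<Longrightarrow> 0 \<le> r \<Longrightarrow> enn_powr (ennreal r) a = ennreal (r powr a)"
  by (auto simp: enn_powr_def ennreal_eq_0_iff)

lemma enn_powr_top: "0 < a \<Longrightarrow> enn_powr top a = top"
  by (simp add: enn_powr_def)

lemma enn_powr_0: "0 < a \<Longrightarrow> enn_powr 0 a = 0"
  by (simp add: enn_powr_def)

lemma enn_powr_1: "enn_powr x 1 = x"
  by (cases x) (auto simp: enn_powr_ennreal enn_powr_top)

lemma enn_powr_mono:
  assumes "0 < a" "x \<le> y"
  shows "enn_powr x a \<le> enn_powr y a"
  using assms by (cases x; cases y) (auto simp: enn_powr_ennreal enn_powr_top powr_mono2 top_unique)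

lemma enn_powr_mult:
  assumes a: "0 < a"
  shows "enn_powr (x * y) a = enn_powr x a * enn_powr y a"
proof (cases "x = 0 \<or> y = 0")
  case True
  then show ?thesis using a by (auto simp: enn_powr_0)
next
  case False
  have nz: "enn_powr z a \<noteq> 0" if "z \<noteq> 0" for z
    using that a by (cases z) (auto simp: enn_powr_ennreal enn_powr_top ennreal_eq_0_iff)
  show ?thesis
  proof (cases "x = top \<or> y = top")
    case True
    then have "x * y = top" using False by (auto simp: ennreal_mult_eq_top_iff)
    moreover have "enn_powr x a * enn_powr y a = top"
    proof -
      have "enn_powr x a \<noteq> 0" "enn_powr y a \<noteq> 0" using False by (simp_all add: nz)
      then show ?thesis using True a by (auto simp: enn_powr_top ennreal_mult_eq_top_iff)
    qed
    ultimately show ?thesis using a by (simp add: enn_powr_top)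
  next
    case False
    then show ?thesis
      using a by (cases x; cases y) (auto simp: ennreal_mult[symmetric] enn_powr_ennreal powr_mult)
  qed
qed

lemma enn_powr_powr:
  assumes "0 < a" "0 < c"
  shows "enn_powr (enn_powr x a) c = enn_powr x (a * c)"
  using assms by (cases x) (auto simp: enn_powr_ennreal enn_powr_top powr_powr)

text \<open>The \<open>s\<close>-th root of an estimate of the form given by \<open>weighted_oscillation_estimate\<close>; the root of
  \<open>4/3\<close> is at most \<open>4/3\<close>.\<close>
lemma enn_powr_root_le:
  assumes s: "1 < s" and Y: "0 \<le> Y" and X: "X \<le> ennreal (4/3 * Y powr s) * K * A"
  shows "enn_powr X (1 / s) \<le> ennreal (4/3 * Y) * enn_powr K (1 / s) * enn_powr A (1 / s)"
proof -
  have pos: "0 < 1 / s" using s by simp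
  have "enn_powr (ennreal (4/3 * Y powr s)) (1 / s) = ennreal ((4/3 * Y powr s) powr (1 / s))"
    using pos by (intro enn_powr_ennreal) auto
  also have "(4/3 * Y powr s) powr (1 / s) = (4/3) powr (1 / s) * Y"
    unfolding powr_mult powr_powr using s Y by simp
  also have "\<dots> \<le> 4/3 * Y"
    using s Y powr_mono[of "1 / s" 1 "4/3::real"] by (intro mult_right_mono) auto
  finally have c: "enn_powr (ennreal (4/3 * Y powr s)) (1 / s) \<le> ennreal (4/3 * Y)"
    by (simp add: ennreal_leI)
  have "enn_powr X (1 / s) \<le> enn_powr (ennreal (4/3 * Y powr s) * K * A) (1 / s)"
    using pos X by (rule enn_powr_mono)
  also have "\<dots> = enn_powr (ennreal (4/3 * Y powr s)) (1 / s) * enn_powr K (1 / s) * enn_powr A (1 / s)"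
    using pos by (simp add: enn_powr_mult)
  also have "\<dots> \<le> ennreal (4/3 * Y) * enn_powr K (1 / s) * enn_powr A (1 / s)"
    by (intro mult_right_mono c) auto
  finally show ?thesis .
qed

section \<open>Properties of Muckenhoupt weights\<close>

lemma cube_sets: "Q \<in> cubes \<Longrightarrow> Q \<in> sets lebesgue"
  by (auto simp: cubes_def)

lemma cube_emeasure: "Q \<in> cubes \<Longrightarrow> emeasure lebesgue Q \<noteq> 0 \<and> emeasure lebesgue Q \<noteq> top"
proof -
  assume "Q \<in> cubes"
  then obtain a h where Q: "Q = cbox a (a + (\<chi> i. h))" "hcube a h \<in> hcubes" using cubes_hcube by blast
  show ?thesis
    using hcube_emeasure_pos[OF Q(2)] unfolding Q(1) emeasure_hcube_cbox by (auto simp del: emeasure_completion)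
qed

lemma wmass_cube:
  assumes w: "weight w" and Q: "Q \<in> cubes"
  shows "wmass w Q = ennreal (mean w Q) * emeasure lebesgue Q"
proof -
  obtain a h where Q: "Q = cbox a (a + (\<chi> i. h))" "hcube a h \<in> hcubes" using cubes_hcube[OF Q] by blast
  have lw: "locally_integrable w" using w by (simp add: weight_def)
  show ?thesis using wmass_eq_mean[OF w Q(2)]
    unfolding Q(1) emeasure_hcube_cbox wmass_hcube mean_hcube[OF lw] .
qed

lemma mean_cube_pos:
  assumes w: "weight w" and pos: "AE x in lebesgue. 0 < w x" and Q: "Q \<in> cubes"
  shows "0 < mean w Q"
proof -
  obtain a h where Q: "Q = cbox a (a + (\<chi> i. h))" "hcube a h \<in> hcubes" using cubes_hcube[OF Q] by blast
  have lw: "locally_integrable w" using w by (simp add: weight_def)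
  show ?thesis using mean_pos[OF w pos Q(2)] unfolding Q(1) mean_hcube[OF lw] .
qed

lemma wmass_cube_neq:
  assumes w: "weight w" and pos: "AE x in lebesgue. 0 < w x" and Q: "Q \<in> cubes"
  shows "wmass w Q \<noteq> 0" "wmass w Q \<noteq> top"
  unfolding wmass_cube[OF w Q] using mean_cube_pos[OF assms] cube_emeasure[OF Q]
  by (auto simp: ennreal_mult_eq_top_iff simp del: emeasure_completion)

lemma nn_avg_weight:
  assumes w: "weight w" and Q: "Q \<in> cubes"
  shows "nn_avg Q (\<lambda>x. ennreal (w x)) = ennreal (mean w Q)"
  using cube_emeasure[OF Q] wmass_cube[OF assms] unfolding nn_avg_def wmass_def
  by (simp add: ennreal_mult_divide_eq del: emeasure_completion)

text \<open>Cubes with an integer half side, so that countably many of them exhaust the space. \<open>Suc k\<close> keeps the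
  side positive for \<open>k = 0\<close>.\<close>
definition centred_cube :: "real ^ 'n \<Rightarrow> nat \<Rightarrow> (real ^ 'n) set" where
  "centred_cube x k = cbox (x - (\<chi> i. real (Suc k))) (x - (\<chi> i. real (Suc k)) + (\<chi> i. 2 * real (Suc k)))"

lemma centred_cube_mem: "y \<in> centred_cube x k \<longleftrightarrow> (\<forall>i. \<bar>y $ i - x $ i\<bar> \<le> real (Suc k))"
proof -
  have "a - r \<le> z \<and> z \<le> a - r + 2 * r \<longleftrightarrow> \<bar>z - a\<bar> \<le> r" for a r z :: real by linarith
  then show ?thesis by (simp add: centred_cube_def mem_box_cart del: of_nat_Suc)
qed

lemma centred_cube_cubes: "centred_cube x k \<in> cubes"
  unfolding cubes_def centred_cube_def
  by (intro CollectI exI conjI) (rule refl, simp)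

lemma centred_cube_mono: "k \<le> j \<Longrightarrow> centred_cube x k \<subseteq> centred_cube x j"
proof
  assume k: "k \<le> j"
  fix y assume "y \<in> centred_cube x k"
  then have "\<bar>y $ i - x $ i\<bar> \<le> real (Suc k)" for i by (simp only: centred_cube_mem)
  moreover have "real (Suc k) \<le> real (Suc j)" using k by simp
  ultimately show "y \<in> centred_cube x j" unfolding centred_cube_mem by (meson order_trans)
qed

lemma centred_cube_exhaust: "\<exists>k. y \<in> centred_cube x k"
proof -
  obtain k :: nat where k: "norm (y - x) \<le> real k" using real_arch_simple by blast
  have "\<bar>y $ i - x $ i\<bar> \<le> real (Suc k)" for i
    using k component_le_norm_cart[of "y - x" i] by simp
  then show ?thesis by (auto simp: centred_cube_mem)
qed

lemma weight_AE_0: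
  assumes w: "weight w" and z: "\<And>k. k0 \<le> k \<Longrightarrow> wmass w (centred_cube x k) = 0"
  shows "AE y in lebesgue. w y = 0"
proof -
  have [measurable]: "w \<in> borel_measurable lebesgue" using w by (simp add: weight_def locally_integrable_measurable)
  have "AE y in lebesgue. k0 \<le> k \<longrightarrow> y \<in> centred_cube x k \<longrightarrow> w y = 0" for k
  proof (cases "k0 \<le> k")
    case True
    have [measurable]: "centred_cube x k \<in> sets lebesgue" by (rule cube_sets[OF centred_cube_cubes])
    have "AE y in lebesgue. ennreal (w y) * indicator (centred_cube x k) y = 0"
      using z[OF True] unfolding wmass_def by (subst (asm) nn_integral_0_iff_AE) auto
    then show ?thesis
    proof eventually_elim
      case (elim y)
      then show ?case using w by (auto simp: weight_def ennreal_eq_0_iff intro: antisym)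
    qed
  qed simp
  then have "AE y in lebesgue. \<forall>k. k0 \<le> k \<longrightarrow> y \<in> centred_cube x k \<longrightarrow> w y = 0"
    unfolding AE_all_countable by (rule allI)
  then show ?thesis
  proof eventually_elim
    case (elim y)
    obtain k where "y \<in> centred_cube x k" using centred_cube_exhaust by blast
    then have "y \<in> centred_cube x (max k k0)" using centred_cube_mono[of k "max k k0" x] by auto
    then show ?case using elim by (metis max.cobounded2)
  qed
qed

text \<open>The infimum that defines the \<open>A\<^sub>1\<close> constant is attained: the exceptional null sets for the constants
  \<open>A + 1 / (n + 1)\<close> have a null union.\<close>
lemma A1_const_AE:
  assumes w: "weight w" and fin: "A1_const w < \<infinity>"
  shows "AE x in lebesgue. maximal w x \<le> A1_const w * ennreal (w x)"
proof -
  obtain A where A: "A1_const w = ennreal A" "0 \<le> A" using fin by (cases "A1_const w") auto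
  have "AE x in lebesgue. maximal w x \<le> ennreal ((A + 1 / real (Suc n)) * w x)" for n
  proof -
    have "A1_const w < ennreal (A + 1 / real (Suc n))"
      unfolding A(1) using A(2) by (intro ennreal_lessI) (auto intro: add_nonneg_pos)
    then obtain C where C: "AE x in lebesgue. maximal w x \<le> C * ennreal (w x)" "C < ennreal (A + 1 / real (Suc n))"
      unfolding A1_const_def by (auto simp: Inf_less_iff)
    show ?thesis using C(1)
    proof eventually_elim
      case (elim x)
      have "C * ennreal (w x) \<le> ennreal (A + 1 / real (Suc n)) * ennreal (w x)"
        using C(2) by (intro mult_right_mono) auto
      also have "\<dots> = ennreal ((A + 1 / real (Suc n)) * w x)"
        using A(2) w by (intro ennreal_mult[symmetric]) (auto simp: weight_def)
      finally show ?case using elim by (rule order_trans[rotated])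
    qed
  qed
  then have "AE x in lebesgue. \<forall>n. maximal w x \<le> ennreal ((A + 1 / real (Suc n)) * w x)"
    unfolding AE_all_countable by (rule allI)
  then show ?thesis
  proof eventually_elim
    case (elim x)
    have "(\<lambda>n. ennreal ((A + 1 / real (Suc n)) * w x)) \<longlonglongrightarrow> ennreal ((A + 0) * w x)"
      by (intro tendsto_ennrealI tendsto_mult tendsto_add tendsto_const)
        (rule LIMSEQ_Suc[OF lim_1_over_n])
    then have "maximal w x \<le> ennreal (A * w x)"
      using elim by (intro LIMSEQ_le_const) auto
    also have "\<dots> = A1_const w * ennreal (w x)"
      unfolding A(1) using A(2) w by (intro ennreal_mult) (auto simp: weight_def)
    finally show ?case .
  qed
qed

lemma nn_avg_le_maximal:
  assumes "weight w" "Q \<in> cubes" "x \<in> Q"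
  shows "ennreal (mean w Q) \<le> maximal w x"
proof -
  have "ennreal (mean w Q) = nn_avg Q (\<lambda>y. ennreal \<bar>w y\<bar>)"
    using assms(1) nn_avg_weight[OF assms(1,2)] by (simp add: weight_def)
  also have "\<dots> \<le> maximal w x" unfolding maximal_def using assms by (intro SUP_upper) auto
  finally show ?thesis .
qed

text \<open>If \<open>w\<close> vanishes on a set of positive measure, then \<open>M w \<le> [w] w\<close> gives a point where \<open>M w = 0\<close>, and
  all cubes around that point have mass \<open>0\<close>.\<close>
lemma A1_weight_dichotomy:
  assumes "w \<in> A1_weights"
  shows "(AE x in lebesgue. w x = 0) \<or> (AE x in lebesgue. 0 < w x)"
proof (rule disjCI)
  have w: "weight w" and fin: "A1_const w < \<infinity>" using assms by (auto simp: A1_weights_def)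
  assume np: "\<not> (AE x in lebesgue. 0 < w x)"
  have "\<exists>x. w x = 0 \<and> maximal w x = 0"
  proof (rule ccontr)
    assume none: "\<nexists>x. w x = 0 \<and> maximal w x = 0"
    have "AE x in lebesgue. 0 < w x" using A1_const_AE[OF w fin]
    proof eventually_elim
      case (elim x)
      show ?case
      proof (rule ccontr)
        assume "\<not> 0 < w x"
        then have "w x = 0" using w by (auto simp: weight_def intro: antisym)
        then show False using elim none by auto
      qed
    qed
    then show False using np by simp
  qed
  then obtain x where x: "maximal w x = 0" by blast
  show "AE x in lebesgue. w x = 0"
  proof (rule weight_AE_0[OF w])
    fix k :: nat
    have "x \<in> centred_cube x k" by (simp add: centred_cube_mem)
    then have "ennreal (mean w (centred_cube x k)) \<le> 0"
      using nn_avg_le_maximal[OF w centred_cube_cubes] x by metis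
    then show "wmass w (centred_cube x k) = 0"
      unfolding wmass_cube[OF w centred_cube_cubes] by simp
  qed
qed

text \<open>If \<open>w\<close> vanishes on a set of positive measure, then the average of \<open>w\<^sup>1\<^sup>-\<^sup>p\<^sup>'\<close> is infinite on every large
  cube. The \<open>A\<^sub>p\<close> constant being finite, the average of \<open>w\<close> must then be \<open>0\<close> there.\<close>
lemma Ap_weight_dichotomy:
  fixes w :: "real ^ 'n \<Rightarrow> real"
  assumes p: "1 < p" and "w \<in> Ap_weights p"
  shows "(AE x in lebesgue. w x = 0) \<or> (AE x in lebesgue. 0 < w x)"
proof (rule disjCI)
  have w: "weight w" and fin: "Ap_const p w < \<infinity>" using assms by (auto simp: Ap_weights_def)
  have w0: "0 \<le> w x" for x using w by (simp add: weight_def)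
  have [measurable]: "w \<in> borel_measurable lebesgue" using w by (simp add: weight_def locally_integrable_measurable)
  assume np: "\<not> (AE x in lebesgue. 0 < w x)"
  let ?Z = "{x \<in> space lebesgue. w x \<le> 0}"
  have Zm: "?Z \<in> sets lebesgue" by measurable
  have "\<exists>k. emeasure lebesgue (?Z \<inter> centred_cube 0 k) \<noteq> 0"
  proof (rule ccontr)
    assume none: "\<nexists>k. emeasure lebesgue (?Z \<inter> centred_cube 0 k) \<noteq> 0"
    have "AE x in lebesgue. x \<notin> ?Z \<inter> centred_cube 0 k" for k
    proof (rule AE_not_in)
      have "?Z \<inter> centred_cube 0 k \<in> sets lebesgue" by (intro sets.Int cube_sets[OF centred_cube_cubes] Zm)
      then show "?Z \<inter> centred_cube 0 k \<in> null_sets lebesgue" using none by (simp add: null_sets_def)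
    qed
    then have "AE x in lebesgue. \<forall>k. x \<notin> ?Z \<inter> centred_cube 0 k" unfolding AE_all_countable by (rule allI)
    then have "AE x in lebesgue. 0 < w x"
    proof eventually_elim
      case (elim x)
      then show ?case using centred_cube_exhaust[of x 0] by auto
    qed
    then show False using np by simp
  qed
  then obtain k0 where k0: "emeasure lebesgue (?Z \<inter> centred_cube 0 k0) \<noteq> 0" by blast
  show "AE x in lebesgue. w x = 0"
  proof (rule weight_AE_0[OF w])
    fix k assume k: "k0 \<le> k"
    let ?Q = "centred_cube 0 k :: (real ^ 'n) set"
    let ?\<sigma> = "\<lambda>x. enn_powr (ennreal (w x)) (1 - dual_exp p)"
    have Q: "?Q \<in> cubes" by (rule centred_cube_cubes)
    have Zs: "?Z \<inter> centred_cube 0 k0 \<in> sets lebesgue" by (intro sets.Int cube_sets[OF centred_cube_cubes] Zm)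
    have neg: "1 - dual_exp p < 0" using p by (simp add: dual_exp_def field_simps)
    have "top = (\<integral>\<^sup>+x. top * indicator (?Z \<inter> centred_cube 0 k0) x \<partial>lebesgue)"
      using k0 by (subst nn_integral_cmult_indicator[OF Zs]) (simp add: ennreal_top_mult del: emeasure_completion)
    also have "\<dots> \<le> (\<integral>\<^sup>+x\<in>?Q. ?\<sigma> x \<partial>lebesgue)"
    proof (rule nn_integral_mono)
      fix x
      show "top * indicator (?Z \<inter> centred_cube 0 k0) x \<le> ?\<sigma> x * indicator ?Q x"
      proof (cases "x \<in> ?Z \<inter> centred_cube 0 k0")
        case True
        then have "x \<in> ?Q" using centred_cube_mono[OF k] by blast
        moreover have "?\<sigma> x = top" using True neg by (auto simp: enn_powr_def ennreal_neg)
        ultimately show ?thesis by simp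
      qed simp
    qed
    finally have "nn_avg ?Q ?\<sigma> = top"
      unfolding nn_avg_def using cube_emeasure[OF Q]
      by (simp add: top_unique ennreal_top_divide del: emeasure_completion)
    then have "enn_powr (nn_avg ?Q ?\<sigma>) (p - 1) = top" using p by (simp add: enn_powr_top)
    moreover have "nn_avg ?Q (\<lambda>x. ennreal (w x)) * enn_powr (nn_avg ?Q ?\<sigma>) (p - 1) \<le> Ap_const p w"
      unfolding Ap_const_def using Q by (rule SUP_upper)
    ultimately have "ennreal (mean w ?Q) * top \<noteq> top"
      using fin unfolding nn_avg_weight[OF w Q] by (auto simp: top_unique)
    then have "ennreal (mean w ?Q) = 0" by (simp add: ennreal_mult_eq_top_iff)
    then show "wmass w ?Q = 0" unfolding wmass_cube[OF w Q] by simp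
  qed
qed

lemma weighted_avg_AE_0:
  fixes Q :: "(real ^ 'n) set"
  assumes "AE x in lebesgue. x \<in> Q \<longrightarrow> f x * ennreal (w x) = 0"
  shows "weighted_avg w Q f = 0"
proof -
  have "(\<integral>\<^sup>+x\<in>Q. f x * ennreal (w x) \<partial>lebesgue) = (\<integral>\<^sup>+x. 0 \<partial>(lebesgue :: (real ^ 'n) measure))"
    by (rule nn_integral_cong_AE, use assms in eventually_elim) (auto split: split_indicator)
  then show ?thesis by (simp add: weighted_avg_def)
qed

text \<open>The \<open>A\<^sub>p\<close> condition raised to the power \<open>p' - 1 = 1 / (p - 1)\<close>.\<close>
lemma Ap_key:
  fixes w :: "real ^ 'n \<Rightarrow> real"
  assumes p: "1 < p" and w: "weight w" "AE x in lebesgue. 0 < w x" and Q: "Q \<in> cubes"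
  shows "ennreal (mean w Q powr (dual_exp p - 1)) * (\<integral>\<^sup>+x\<in>Q. ennreal (w x powr (1 - dual_exp p)) \<partial>lebesgue)
    \<le> enn_powr (Ap_const p w) (dual_exp p - 1) * emeasure lebesgue Q"
proof -
  let ?s = "dual_exp p"
  let ?\<sigma> = "\<lambda>x. enn_powr (ennreal (w x)) (1 - ?s)"
  have s1: "0 < ?s - 1" and conj: "(p - 1) * (?s - 1) = 1" using p by (auto simp: dual_exp_def field_simps)
  have "(\<integral>\<^sup>+x\<in>Q. ?\<sigma> x \<partial>lebesgue) = (\<integral>\<^sup>+x\<in>Q. ennreal (w x powr (1 - ?s)) \<partial>lebesgue)"
    by (rule nn_integral_cong_AE, use w(2) in eventually_elim)
      (use s1 in \<open>auto simp: enn_powr_def ennreal_eq_0_iff\<close>)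
  then have avg: "nn_avg Q ?\<sigma> * emeasure lebesgue Q = (\<integral>\<^sup>+x\<in>Q. ennreal (w x powr (1 - ?s)) \<partial>lebesgue)"
    unfolding nn_avg_def using cube_emeasure[OF Q]
    by (simp add: ennreal_divide_times ennreal_divide_self less_top del: emeasure_completion)
  have "ennreal (mean w Q) * enn_powr (nn_avg Q ?\<sigma>) (p - 1) \<le> Ap_const p w"
    unfolding Ap_const_def nn_avg_weight[OF w(1) Q, symmetric] using Q by (rule SUP_upper)
  then have "enn_powr (ennreal (mean w Q) * enn_powr (nn_avg Q ?\<sigma>) (p - 1)) (?s - 1) \<le> enn_powr (Ap_const p w) (?s - 1)"
    using s1 by (intro enn_powr_mono)
  moreover have "enn_powr (ennreal (mean w Q) * enn_powr (nn_avg Q ?\<sigma>) (p - 1)) (?s - 1)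
      = ennreal (mean w Q powr (?s - 1)) * nn_avg Q ?\<sigma>"
    using s1 p mean_cube_pos[OF w Q] conj
    by (simp add: enn_powr_mult enn_powr_powr enn_powr_ennreal enn_powr_1)
  ultimately have "ennreal (mean w Q powr (?s - 1)) * nn_avg Q ?\<sigma> * emeasure lebesgue Q
      \<le> enn_powr (Ap_const p w) (?s - 1) * emeasure lebesgue Q"
    by (intro mult_right_mono) auto
  then show ?thesis unfolding mult.assoc avg .
qed

lemma A1_mean_le:
  assumes w: "weight w" and A: "A1_const w = ennreal A" "0 \<le> A" and Q: "Q \<in> cubes"
  shows "AE x in lebesgue. x \<in> Q \<longrightarrow> mean w Q \<le> A * w x"
proof -
  have "A1_const w < \<infinity>" using A by simp
  from A1_const_AE[OF w this] show ?thesis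
  proof eventually_elim
    case (elim x)
    show ?case
    proof
      assume "x \<in> Q"
      then have "ennreal (mean w Q) \<le> ennreal A * ennreal (w x)"
        using nn_avg_le_maximal[OF w Q] elim unfolding A(1) by (blast intro: order_trans)
      also have "\<dots> = ennreal (A * w x)" using A w by (intro ennreal_mult[symmetric]) (auto simp: weight_def)
      finally show "mean w Q \<le> A * w x" using A w by (subst (asm) ennreal_le_iff) (auto simp: weight_def)
    qed
  qed
qed

lemma A1_key:
  fixes w :: "real ^ 'n \<Rightarrow> real"
  assumes q: "1 < q" and w: "weight w" "AE x in lebesgue. 0 < w x" and A: "A1_const w = ennreal A" "0 \<le> A"
    and Q: "Q \<in> cubes"
  shows "ennreal (mean w Q powr (q - 1)) * (\<integral>\<^sup>+x\<in>Q. ennreal (w x powr (1 - q)) \<partial>lebesgue)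
    \<le> ennreal (A powr (q - 1)) * emeasure lebesgue Q"
proof -
  have [measurable]: "w \<in> borel_measurable lebesgue" "Q \<in> sets lebesgue"
    using w Q by (auto simp: weight_def locally_integrable_measurable cube_sets)
  have "ennreal (mean w Q powr (q - 1)) * (\<integral>\<^sup>+x\<in>Q. ennreal (w x powr (1 - q)) \<partial>lebesgue)
      = (\<integral>\<^sup>+x. ennreal (mean w Q powr (q - 1)) * (ennreal (w x powr (1 - q)) * indicator Q x) \<partial>lebesgue)"
    by (rule nn_integral_cmult[symmetric]) simp
  also have "\<dots> \<le> (\<integral>\<^sup>+x. ennreal (A powr (q - 1)) * indicator Q x \<partial>lebesgue)"
  proof (rule nn_integral_mono_AE, use w(2) A1_mean_le[OF w(1) A Q] in eventually_elim)
    fix x assume x: "0 < w x" "x \<in> Q \<longrightarrow> mean w Q \<le> A * w x"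
    show "ennreal (mean w Q powr (q - 1)) * (ennreal (w x powr (1 - q)) * indicator Q x)
        \<le> ennreal (A powr (q - 1)) * indicator Q x"
    proof (cases "x \<in> Q")
      case True
      have "mean w Q powr (q - 1) \<le> (A * w x) powr (q - 1)"
        using True x q mean_cube_pos[OF w Q] by (intro powr_mono2) auto
      also have "\<dots> = A powr (q - 1) * w x powr (q - 1)" by (rule powr_mult)
      finally have "mean w Q powr (q - 1) * w x powr (1 - q) \<le> A powr (q - 1) * w x powr (q - 1) * w x powr (1 - q)"
        by (intro mult_right_mono) auto
      also have "\<dots> = A powr (q - 1)" using x by (simp add: mult.assoc powr_add[symmetric])
      finally show ?thesis using True by (simp add: ennreal_mult[symmetric] ennreal_leI)
    qed simp
  qed
  also have "\<dots> = ennreal (A powr (q - 1)) * emeasure lebesgue Q"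
    by (rule nn_integral_cmult_indicator) simp
  finally show ?thesis .
qed

lemma A1_const_ge_1:
  fixes w :: "real ^ 'n \<Rightarrow> real"
  assumes w: "weight w" "AE x in lebesgue. 0 < w x" and A: "A1_const w = ennreal A" "0 \<le> A"
  shows "1 \<le> A"
proof -
  let ?Q = "centred_cube 0 0 :: (real ^ 'n) set"
  have Q: "?Q \<in> cubes" by (rule centred_cube_cubes)
  have [measurable]: "w \<in> borel_measurable lebesgue" "?Q \<in> sets lebesgue"
    using w cube_sets[OF Q] by (auto simp: weight_def locally_integrable_measurable)
  obtain v where v: "wmass w ?Q = ennreal v" "0 < v"
    using wmass_cube_neq[OF w Q] by (cases "wmass w ?Q") (auto simp: ennreal_eq_0_iff not_le)
  have "wmass w ?Q = (\<integral>\<^sup>+x. ennreal (mean w ?Q) * indicator ?Q x \<partial>lebesgue)"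
    unfolding wmass_cube[OF w(1) Q] by (rule nn_integral_cmult_indicator[symmetric]) simp
  also have "\<dots> \<le> (\<integral>\<^sup>+x. ennreal A * (ennreal (w x) * indicator ?Q x) \<partial>lebesgue)"
  proof (rule nn_integral_mono_AE, use A1_mean_le[OF w(1) A Q] in eventually_elim)
    fix x assume "x \<in> ?Q \<longrightarrow> mean w ?Q \<le> A * w x"
    then show "ennreal (mean w ?Q) * indicator ?Q x \<le> ennreal A * (ennreal (w x) * indicator ?Q x)"
      using A(2) by (auto simp: ennreal_mult'[symmetric] intro: ennreal_leI split: split_indicator)
  qed
  also have "\<dots> = ennreal A * wmass w ?Q"
    unfolding wmass_def by (rule nn_integral_cmult) simp
  finally have "ennreal v \<le> ennreal (A * v)" unfolding v using A v by (simp add: ennreal_mult)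
  then have "v \<le> A * v" using A v by (subst (asm) ennreal_le_iff) auto
  then show ?thesis using v by simp
qed

lemma Ainf_le_A1:
  fixes w :: "real ^ 'n \<Rightarrow> real"
  assumes w: "weight w" "AE x in lebesgue. 0 < w x" and fin: "A1_const w < \<infinity>"
  shows "Ainf_const w \<le> A1_const w"
  unfolding Ainf_const_def
proof (rule SUP_least)
  fix Q :: "(real ^ 'n) set" assume Q: "Q \<in> cubes"
  have [measurable]: "w \<in> borel_measurable lebesgue" "Q \<in> sets lebesgue"
    using w cube_sets[OF Q] by (auto simp: weight_def locally_integrable_measurable)
  have mono: "maximal (\<lambda>y. w y * indicator Q y) x \<le> maximal w x" for x
    unfolding maximal_def nn_avg_def
    by (intro SUP_mono' divide_right_mono_ennreal nn_integral_mono mult_right_mono ennreal_leI)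
      (auto split: split_indicator)
  have "(\<integral>\<^sup>+x\<in>Q. maximal (\<lambda>y. w y * indicator Q y) x \<partial>lebesgue)
      \<le> (\<integral>\<^sup>+x. A1_const w * (ennreal (w x) * indicator Q x) \<partial>lebesgue)"
  proof (rule nn_integral_mono_AE, use A1_const_AE[OF w(1) fin] in eventually_elim)
    fix x assume "maximal w x \<le> A1_const w * ennreal (w x)"
    then show "maximal (\<lambda>y. w y * indicator Q y) x * indicator Q x \<le> A1_const w * (ennreal (w x) * indicator Q x)"
      using mono[of x] by (auto intro: order_trans split: split_indicator)
  qed
  also have "\<dots> = A1_const w * wmass w Q" unfolding wmass_def by (rule nn_integral_cmult) simp
  finally have "(\<integral>\<^sup>+x\<in>Q. maximal (\<lambda>y. w y * indicator Q y) x \<partial>lebesgue) / wmass w Q \<le> A1_const w * wmass w Q / wmass w Q"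
    by (rule divide_right_mono_ennreal)
  also have "\<dots> = A1_const w" using wmass_cube_neq[OF w Q] by (simp add: ennreal_mult_divide_eq)
  finally show "(\<integral>\<^sup>+x\<in>Q. maximal (\<lambda>y. w y * indicator Q y) x \<partial>lebesgue) / wmass w Q \<le> A1_const w" .
qed

lemma bmo_norm_le:
  assumes w: "weight w" "AE x in lebesgue. 0 < w x" and Q: "Q \<in> cubes"
  shows "(\<integral>\<^sup>+x\<in>Q. ennreal \<bar>b x - mean b Q\<bar> \<partial>lebesgue) \<le> bmo_norm w b * wmass w Q"
proof -
  have "(\<integral>\<^sup>+x\<in>Q. ennreal \<bar>b x - mean b Q\<bar> \<partial>lebesgue)
      = (\<integral>\<^sup>+x\<in>Q. ennreal \<bar>b x - mean b Q\<bar> \<partial>lebesgue) / wmass w Q * wmass w Q"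
    using wmass_cube_neq[OF w Q] by (simp add: ennreal_divide_times ennreal_divide_self less_top)
  also have "\<dots> \<le> bmo_norm w b * wmass w Q"
    unfolding bmo_norm_def by (intro mult_right_mono SUP_upper Q) auto
  finally show ?thesis .
qed

lemma bmo_norm_0_AE:
  assumes w: "weight w" "AE x in lebesgue. 0 < w x" and b: "locally_integrable b"
    and 0: "bmo_norm w b = 0" and Q: "Q \<in> cubes"
  shows "AE x in lebesgue. x \<in> Q \<longrightarrow> b x = mean b Q"
proof -
  have [measurable]: "b \<in> borel_measurable lebesgue" "Q \<in> sets lebesgue"
    using b Q by (auto simp: locally_integrable_measurable cube_sets)
  have "(\<integral>\<^sup>+x\<in>Q. ennreal \<bar>b x - mean b Q\<bar> \<partial>lebesgue) = 0"
    using bmo_norm_le[OF w Q, of b] 0 by simp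
  then have "AE x in lebesgue. ennreal \<bar>b x - mean b Q\<bar> * indicator Q x = 0"
    by (subst (asm) nn_integral_0_iff_AE) auto
  then show ?thesis by eventually_elim (auto split: split_indicator_asm)
qed

section \<open>Moments of the oscillation\<close>

text \<open>A vanishing BMO norm forces \<open>b = b\<^sub>Q\<close> almost everywhere on \<open>Q\<close>.\<close>
lemma weighted_avg_oscillation_0:
  fixes w :: "real ^ 'n \<Rightarrow> real"
  assumes w: "weight w" "AE x in lebesgue. 0 < w x" and b: "locally_integrable b"
    and 0: "bmo_norm w b = 0" and Q: "Q \<in> cubes" and F: "F 0 = 0"
  shows "weighted_avg w Q (\<lambda>x. ennreal (F ((b x - mean b Q) / w x))) = 0"
  using bmo_norm_0_AE[OF w b 0 Q] by (intro weighted_avg_AE_0, elim eventually_mono) (simp add: F)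

lemma dual_exp_facts:
  assumes "1 < p"
  shows "1 < dual_exp p" "(dual_exp p - 1) * (1 / dual_exp p) = 1 / p" "1 / dual_exp p = (p - 1) / p"
  using assms by (auto simp: dual_exp_def field_simps)

text \<open>A vanishing BMO norm is treated apart: the product on the right is then \<open>0\<close> even if the
  Fujii--Wilson constant is infinite.\<close>
lemma weighted_oscillation_le:
  fixes w :: "real ^ 'n \<Rightarrow> real"
  assumes w: "weight w" "AE x in lebesgue. 0 < w x" and b: "b \<in> BMO w" and s: "1 < s"
    and key: "\<And>Q. Q \<in> cubes \<Longrightarrow> ennreal (mean w Q powr (s - 1)) * (\<integral>\<^sup>+x\<in>Q. ennreal (w x powr (1 - s)) \<partial>lebesgue)
      \<le> enn_powr A (s - 1) * emeasure lebesgue Q"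
    and Q: "Q \<in> cubes"
  shows "enn_powr (weighted_avg w Q (\<lambda>x. ennreal (\<bar>(b x - mean b Q) / w x\<bar> powr s))) (1 / s)
    \<le> ennreal (32/3 * 2 ^ CARD('n)) * ennreal s * bmo_norm w b * enn_powr A ((s - 1) * (1 / s)) * enn_powr (Ainf_const w) (1 / s)"
proof (cases "bmo_norm w b = 0")
  case True
  have "locally_integrable b" using b by (simp add: BMO_def)
  then have "weighted_avg w Q (\<lambda>x. ennreal (\<bar>(b x - mean b Q) / w x\<bar> powr s)) = 0"
    using weighted_avg_oscillation_0[OF w _ True Q, of "\<lambda>z. \<bar>z\<bar> powr s"] by simp
  then show ?thesis using s by (simp add: enn_powr_0)
next
  case False
  have bl: "locally_integrable b" and "bmo_norm w b < \<infinity>" using b by (auto simp: BMO_def)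
  then obtain B where B: "bmo_norm w b = ennreal B" "0 < B"
    using False by (cases "bmo_norm w b") (auto simp: ennreal_eq_0_iff not_le)
  let ?Y = "2 * s * (4 * 2 ^ CARD('n) * B)"
  have "weighted_avg w Q (\<lambda>x. ennreal (\<bar>(b x - mean b Q) / w x\<bar> powr s))
      \<le> ennreal (4/3 * ?Y powr s) * enn_powr A (s - 1) * Ainf_const w"
    by (rule weighted_oscillation_estimate[OF w bl B(2) _ s key Q]) (use bmo_norm_le[OF w, of _ b] B(1) in auto)
  then have "enn_powr (weighted_avg w Q (\<lambda>x. ennreal (\<bar>(b x - mean b Q) / w x\<bar> powr s))) (1 / s)
      \<le> ennreal (4/3 * ?Y) * enn_powr (enn_powr A (s - 1)) (1 / s) * enn_powr (Ainf_const w) (1 / s)"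
    using s B(2) by (intro enn_powr_root_le) auto
  also have "enn_powr (enn_powr A (s - 1)) (1 / s) = enn_powr A ((s - 1) * (1 / s))"
    using s by (intro enn_powr_powr) auto
  also have "ennreal (4/3 * ?Y) = ennreal (32/3 * 2 ^ CARD('n)) * ennreal s * bmo_norm w b"
    unfolding B(1) using s B(2) by (simp add: ennreal_mult[symmetric] field_simps)
  finally show ?thesis .
qed

lemma Ap_oscillation_le:
  fixes w :: "real ^ 'n \<Rightarrow> real"
  assumes p: "1 < p" and A: "w \<in> Ap_weights p" and b: "b \<in> BMO w" and Q: "Q \<in> cubes"
  shows "enn_powr (weighted_avg w Q (\<lambda>x. ennreal (\<bar>(b x - mean b Q) / w x\<bar> powr dual_exp p))) (1 / dual_exp p)
    \<le> ennreal (32/3 * 2 ^ CARD('n)) * ennreal (dual_exp p) * bmo_norm w b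
      * enn_powr (Ap_const p w) (1 / p) * enn_powr (Ainf_const w) (1 / dual_exp p)"
proof -
  have w: "weight w" using A by (simp add: Ap_weights_def)
  have s: "1 < dual_exp p" using dual_exp_facts(1)[OF p] .
  from Ap_weight_dichotomy[OF p A] show ?thesis
  proof
    assume "AE x in lebesgue. w x = 0"
    then have "weighted_avg w Q (\<lambda>x. ennreal (\<bar>(b x - mean b Q) / w x\<bar> powr dual_exp p)) = 0"
      by (intro weighted_avg_AE_0) (elim eventually_mono, simp)
    then show ?thesis using s by (simp add: enn_powr_0)
  next
    assume pos: "AE x in lebesgue. 0 < w x"
    show ?thesis
      using weighted_oscillation_le[OF w pos b s Ap_key[OF p w pos] Q] unfolding dual_exp_facts(2)[OF p] .
  qed
qed

lemma A1_oscillation_le: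
  fixes w :: "real ^ 'n \<Rightarrow> real"
  assumes q: "1 < q" and A: "w \<in> A1_weights" and b: "b \<in> BMO w" and Q: "Q \<in> cubes"
  shows "enn_powr (weighted_avg w Q (\<lambda>x. ennreal (\<bar>(b x - mean b Q) / w x\<bar> powr q))) (1 / q)
    \<le> ennreal (32/3 * 2 ^ CARD('n)) * bmo_norm w b * ennreal q
      * enn_powr (A1_const w) (1 / dual_exp q) * enn_powr (Ainf_const w) (1 / q)"
proof -
  have w: "weight w" and "A1_const w < \<infinity>" using A by (auto simp: A1_weights_def)
  then obtain a where a: "A1_const w = ennreal a" "0 \<le> a" by (cases "A1_const w") auto
  from A1_weight_dichotomy[OF A] show ?thesis
  proof
    assume "AE x in lebesgue. w x = 0"
    then have "weighted_avg w Q (\<lambda>x. ennreal (\<bar>(b x - mean b Q) / w x\<bar> powr q)) = 0"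
      by (intro weighted_avg_AE_0) (elim eventually_mono, simp)
    then show ?thesis using q by (simp add: enn_powr_0)
  next
    assume pos: "AE x in lebesgue. 0 < w x"
    have K: "enn_powr (A1_const w) (q - 1) = ennreal (a powr (q - 1))"
      unfolding a(1) using q a(2) by (intro enn_powr_ennreal) auto
    have e: "1 / dual_exp q = (q - 1) * (1 / q)" using dual_exp_facts(3)[OF q] by simp
    have "enn_powr (weighted_avg w Q (\<lambda>x. ennreal (\<bar>(b x - mean b Q) / w x\<bar> powr q))) (1 / q)
      \<le> ennreal (32/3 * 2 ^ CARD('n)) * ennreal q * bmo_norm w b
        * enn_powr (A1_const w) ((q - 1) * (1 / q)) * enn_powr (Ainf_const w) (1 / q)"
    proof (rule weighted_oscillation_le[OF w pos b q _ Q])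
      fix Q' :: "(real ^ 'n) set" assume "Q' \<in> cubes"
      then show "ennreal (mean w Q' powr (q - 1)) * (\<integral>\<^sup>+x\<in>Q'. ennreal (w x powr (1 - q)) \<partial>lebesgue)
          \<le> enn_powr (A1_const w) (q - 1) * emeasure lebesgue Q'"
        unfolding K by (rule A1_key[OF q w pos a])
    qed
    then show ?thesis unfolding e by (simp add: mult_ac)
  qed
qed

section \<open>Exponential integrability\<close>

text \<open>The first moment is bounded by the definition of the BMO norm, the higher ones by
  \<open>A1_oscillation_le\<close> with \<open>q = k + 1\<close>; since \<open>[w]\<^sub>A\<^sub>\<infinity> \<le> [w]\<^sub>A\<^sub>1\<close>, the two powers \<open>1/q'\<close> and \<open>1/q\<close>
  of the constants combine to one power of \<open>[w]\<^sub>A\<^sub>1\<close>.\<close>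
lemma A1_moment_le:
  fixes w :: "real ^ 'n \<Rightarrow> real"
  assumes A: "w \<in> A1_weights" and pos: "AE x in lebesgue. 0 < w x" and b: "b \<in> BMO w" and Q: "Q \<in> cubes"
    and a: "A1_const w = ennreal a" "0 \<le> a" and B: "bmo_norm w b = ennreal B" "0 \<le> B"
  shows "weighted_avg w Q (\<lambda>x. ennreal (\<bar>(b x - mean b Q) / w x\<bar> ^ Suc k))
    \<le> ennreal ((32/3 * 2 ^ CARD('n) * a * B * real (Suc k)) ^ Suc k)"
proof -
  have w: "weight w" and fin: "A1_const w < \<infinity>" using A by (auto simp: A1_weights_def)
  have a1: "1 \<le> a" by (rule A1_const_ge_1[OF w pos a])
  let ?c = "32/3 * 2 ^ CARD('n) :: real"
  have c1: "1 \<le> ?c" using one_le_power[of "2::real" "CARD('n)"] by linarith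
  show ?thesis
  proof (cases "k = 0")
    case True
    have "(\<integral>\<^sup>+x\<in>Q. ennreal (\<bar>(b x - mean b Q) / w x\<bar> ^ Suc k) * ennreal (w x) \<partial>lebesgue)
        = (\<integral>\<^sup>+x\<in>Q. ennreal \<bar>b x - mean b Q\<bar> \<partial>lebesgue)"
      by (rule nn_integral_cong_AE, use pos in eventually_elim) (simp add: True ennreal_mult[symmetric])
    also have "\<dots> \<le> bmo_norm w b * wmass w Q" by (rule bmo_norm_le[OF w pos Q])
    finally have "weighted_avg w Q (\<lambda>x. ennreal (\<bar>(b x - mean b Q) / w x\<bar> ^ Suc k)) \<le> bmo_norm w b * wmass w Q / wmass w Q"
      unfolding weighted_avg_def by (rule divide_right_mono_ennreal)
    also have "\<dots> = ennreal B" using wmass_cube_neq[OF w pos Q] B by (simp add: ennreal_mult_divide_eq)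
    also have "\<dots> \<le> ennreal ((?c * a * B * real (Suc k)) ^ Suc k)"
    proof -
      have "1 \<le> ?c * a" using mult_mono[OF c1 a1] by simp
      then have "B \<le> ?c * a * B" using B(2) mult_right_mono by fastforce
      then show ?thesis using True by (intro ennreal_leI) simp
    qed
    finally show ?thesis .
  next
    case False
    define q where "q = real (Suc k)"
    have q: "1 < q" using False by (simp add: q_def)
    define X where "X = weighted_avg w Q (\<lambda>x. ennreal (\<bar>(b x - mean b Q) / w x\<bar> powr q))"
    have "enn_powr X (1 / q) \<le> ennreal ?c * bmo_norm w b * ennreal q
      * enn_powr (A1_const w) (1 / dual_exp q) * enn_powr (Ainf_const w) (1 / q)"
      unfolding X_def by (rule A1_oscillation_le[OF q A b Q])
    also have "\<dots> \<le> ennreal ?c * bmo_norm w b * ennreal q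
      * enn_powr (A1_const w) (1 / dual_exp q) * enn_powr (A1_const w) (1 / q)"
      using q by (intro mult_left_mono enn_powr_mono Ainf_le_A1[OF w pos fin]) auto
    also have "\<dots> = ennreal (?c * B * q * (a powr (1 / dual_exp q) * a powr (1 / q)))"
    proof -
      have "0 < 1 / dual_exp q" using dual_exp_facts(1)[OF q] by simp
      then have e: "enn_powr (A1_const w) (1 / dual_exp q) = ennreal (a powr (1 / dual_exp q))"
        "enn_powr (A1_const w) (1 / q) = ennreal (a powr (1 / q))"
        unfolding a(1) using q a(2) by (auto intro: enn_powr_ennreal)
      have "ennreal c * ennreal B * ennreal q * ennreal u * ennreal v = ennreal (c * B * q * (u * v))"
        if "0 \<le> c" "0 \<le> u" "0 \<le> v" for c u v :: real
        using that B(2) q by (simp add: ennreal_mult mult.assoc)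
      then show ?thesis unfolding e B(1) by simp
    qed
    also have "a powr (1 / dual_exp q) * a powr (1 / q) = a"
    proof -
      have "1 / dual_exp q + 1 / q = 1" unfolding dual_exp_facts(3)[OF q] using q by (simp add: field_simps)
      then show ?thesis using a1 by (simp only: powr_add[symmetric]) simp
    qed
    finally have "enn_powr X (1 / q) \<le> ennreal (?c * a * B * q)" by (simp add: mult_ac)
    then have "enn_powr (enn_powr X (1 / q)) q \<le> enn_powr (ennreal (?c * a * B * q)) q"
      using q by (intro enn_powr_mono) auto
    then have "X \<le> ennreal ((?c * a * B * q) powr q)"
      using q a B by (simp add: enn_powr_powr enn_powr_1 enn_powr_ennreal)
    moreover have pw: "z powr q = z ^ Suc k" if "0 \<le> z" for z :: real
      using that unfolding q_def by (rule powr_realpow')  simp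
    have "0 \<le> ?c * a * B * q" using a(2) B(2) q by simp
    then have "(?c * a * B * q) powr q = (?c * a * B * q) ^ Suc k" by (rule pw)
    moreover have "X = weighted_avg w Q (\<lambda>x. ennreal (\<bar>(b x - mean b Q) / w x\<bar> ^ Suc k))"
      unfolding X_def by (simp only: pw abs_ge_zero)
    ultimately show ?thesis unfolding q_def by metis
  qed
qed

text \<open>\<open>n\<^sup>n / n!\<close> is one term of the exponential series of \<open>n\<close>.\<close>
lemma power_self_le_exp_fact: "real n ^ n \<le> exp 1 ^ n * fact n"
proof -
  have "real n ^ n / fact n \<le> exp (real n)"
  proof -
    have "(\<lambda>k. real n ^ k / fact k) sums exp (real n)"
      using exp_converges[of "real n"] by (simp add: divide_inverse mult.commute)
    then have "sum (\<lambda>k. real n ^ k / fact k) {n} \<le> exp (real n)"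
      by (intro sum_le_suminf[of _ "{n}", THEN order_trans]) (auto simp: sums_iff)
    then show ?thesis by simp
  qed
  also have "exp (real n) = exp 1 ^ n" by (simp add: exp_of_nat_mult[symmetric])
  finally show ?thesis by (simp add: field_simps)
qed

lemma exp_minus_1_sums: "(\<lambda>k. z ^ Suc k / fact (Suc k)) sums (exp z - 1)" for z :: real
proof -
  have "(\<lambda>k. z ^ k / fact k) sums exp z"
    using exp_converges[of z] by (simp add: divide_inverse mult.commute)
  then show ?thesis using sums_Suc_iff[of "\<lambda>k. z ^ k / fact k" "exp z - 1"] by simp
qed

text \<open>Moments of size \<open>(G k)\<^sup>k\<close> give exponential integrability: by \<open>k\<^sup>k \<le> e\<^sup>k k!\<close>, the \<open>k\<close>-th term of the
  power series at height \<open>2 e G\<close> contributes at most \<open>2\<^sup>-\<^sup>k\<close>.\<close>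
lemma weighted_avg_exp_le_1:
  fixes w :: "real ^ 'n \<Rightarrow> real" and g :: "real ^ 'n \<Rightarrow> real"
  assumes w: "weight w" "AE x in lebesgue. 0 < w x" and Q: "Q \<in> cubes" and [measurable]: "g \<in> borel_measurable lebesgue"
    and G: "0 < G" and mom: "\<And>k. weighted_avg w Q (\<lambda>x. ennreal (\<bar>g x\<bar> ^ Suc k)) \<le> ennreal ((G * real (Suc k)) ^ Suc k)"
  shows "weighted_avg w Q (\<lambda>x. ennreal (exp (\<bar>g x\<bar> / (2 * exp 1 * G)) - 1)) \<le> 1"
proof -
  define l where "l = 2 * exp 1 * G"
  define a where "a k = 1 / (fact (Suc k) * l ^ Suc k)" for k
  have l: "0 < l" using G by (simp add: l_def)
  have [measurable]: "w \<in> borel_measurable lebesgue" "Q \<in> sets lebesgue"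
    using w cube_sets[OF Q] by (auto simp: weight_def locally_integrable_measurable)
  have a0: "0 \<le> a k" for k unfolding a_def using l by (simp del: fact_Suc power_Suc)
  have ser: "ennreal (exp (\<bar>g x\<bar> / l) - 1) = (\<Sum>k. ennreal (a k) * ennreal (\<bar>g x\<bar> ^ Suc k))" for x
  proof -
    have "(\<lambda>k. (\<bar>g x\<bar> / l) ^ Suc k / fact (Suc k)) sums (exp (\<bar>g x\<bar> / l) - 1)"
      by (rule exp_minus_1_sums)
    moreover have "(\<bar>g x\<bar> / l) ^ Suc k / fact (Suc k) = a k * \<bar>g x\<bar> ^ Suc k" for k
      unfolding a_def power_divide by (simp del: fact_Suc power_Suc)
    ultimately have s: "(\<lambda>k. a k * \<bar>g x\<bar> ^ Suc k) sums (exp (\<bar>g x\<bar> / l) - 1)" by (simp only:)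
    have "(\<Sum>k. ennreal (a k * \<bar>g x\<bar> ^ Suc k)) = ennreal (exp (\<bar>g x\<bar> / l) - 1)"
      using a0 s by (intro suminf_ennreal_eq) auto
    then show ?thesis using a0 by (simp only: ennreal_mult' )
  qed
  have "(\<integral>\<^sup>+x\<in>Q. ennreal (exp (\<bar>g x\<bar> / l) - 1) * ennreal (w x) \<partial>lebesgue)
      = (\<integral>\<^sup>+x. (\<Sum>k. ennreal (a k) * (ennreal (\<bar>g x\<bar> ^ Suc k) * ennreal (w x) * indicator Q x)) \<partial>lebesgue)"
    unfolding ser by (simp only: ennreal_suminf_multc[symmetric] mult.assoc)
  also have "\<dots> = (\<Sum>k. ennreal (a k) * (\<integral>\<^sup>+x\<in>Q. ennreal (\<bar>g x\<bar> ^ Suc k) * ennreal (w x) \<partial>lebesgue))"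
    by (subst nn_integral_suminf, simp, subst nn_integral_cmult) auto
  also have "\<dots> = (\<Sum>k. ennreal (a k) * weighted_avg w Q (\<lambda>x. ennreal (\<bar>g x\<bar> ^ Suc k))) * wmass w Q"
  proof -
    have "z = z / wmass w Q * wmass w Q" for z
      using wmass_cube_neq[OF w Q] by (simp add: ennreal_divide_times ennreal_divide_self less_top)
    then have "(\<integral>\<^sup>+x\<in>Q. ennreal (\<bar>g x\<bar> ^ Suc k) * ennreal (w x) \<partial>lebesgue)
       = weighted_avg w Q (\<lambda>x. ennreal (\<bar>g x\<bar> ^ Suc k)) * wmass w Q" for k
      unfolding weighted_avg_def .
    then show ?thesis by (simp only: ennreal_suminf_multc[symmetric] mult.assoc)
  qed
  also have "\<dots> \<le> (\<Sum>k. ennreal ((1/2) ^ Suc k)) * wmass w Q"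
  proof (intro mult_right_mono suminf_le)
    fix k
    have "ennreal (a k) * weighted_avg w Q (\<lambda>x. ennreal (\<bar>g x\<bar> ^ Suc k))
        \<le> ennreal (a k) * ennreal ((G * real (Suc k)) ^ Suc k)"
      by (intro mult_left_mono mom) auto
    also have "\<dots> = ennreal (a k * (G * real (Suc k)) ^ Suc k)"
      using a0 by (simp only: ennreal_mult')
    also have "\<dots> \<le> ennreal ((1/2) ^ Suc k)"
    proof (rule ennreal_leI)
      have "a k * (G * real (Suc k)) ^ Suc k = (real (Suc k) ^ Suc k / fact (Suc k)) * (G / l) ^ Suc k"
        unfolding a_def power_mult_distrib power_divide by (simp del: fact_Suc power_Suc of_nat_Suc)
      also have "\<dots> \<le> exp 1 ^ Suc k * (G / l) ^ Suc k"
      proof (rule mult_right_mono)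
        show "real (Suc k) ^ Suc k / fact (Suc k) \<le> exp 1 ^ Suc k"
          using power_self_le_exp_fact[of "Suc k"] by (simp add: divide_le_eq del: fact_Suc power_Suc of_nat_Suc)
        show "0 \<le> (G / l) ^ Suc k" using G l by (intro zero_le_power) simp
      qed
      also have "\<dots> = (exp 1 * (G / l)) ^ Suc k" by (rule power_mult_distrib[symmetric])
      also have "exp 1 * (G / l) = 1/2" using G by (simp add: l_def)
      finally show "a k * (G * real (Suc k)) ^ Suc k \<le> (1/2) ^ Suc k" .
    qed
    finally show "ennreal (a k) * weighted_avg w Q (\<lambda>x. ennreal (\<bar>g x\<bar> ^ Suc k)) \<le> ennreal ((1/2) ^ Suc k)" .
  qed auto
  also have "(\<Sum>k. ennreal ((1/2) ^ Suc k)) = ennreal 1"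
    using power_half_series by (intro suminf_ennreal_eq) auto
  finally have "(\<integral>\<^sup>+x\<in>Q. ennreal (exp (\<bar>g x\<bar> / l) - 1) * ennreal (w x) \<partial>lebesgue) \<le> wmass w Q" by simp
  then have "weighted_avg w Q (\<lambda>x. ennreal (exp (\<bar>g x\<bar> / l) - 1)) \<le> wmass w Q / wmass w Q"
    unfolding weighted_avg_def by (rule divide_right_mono_ennreal)
  also have "\<dots> = 1" using wmass_cube_neq[OF w Q] by (simp add: ennreal_divide_self less_top)
  finally show ?thesis unfolding l_def .
qed

lemma expL_norm_0:
  assumes "\<And>l. 0 < l \<Longrightarrow> weighted_avg w Q (\<lambda>x. ennreal (exp (\<bar>g x\<bar> / l) - 1)) = 0"
  shows "expL_norm Q w g = 0"
proof -
  have "expL_norm Q w g \<le> 0 + ennreal e" if "0 < e" for e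
    unfolding expL_norm_def using that assms[OF that] by (intro Inf_lower) auto
  then have "expL_norm Q w g \<le> 0" by (rule ennreal_le_epsilon)
  then show ?thesis by simp
qed

lemma A1_expL_le:
  fixes w :: "real ^ 'n \<Rightarrow> real"
  assumes A: "w \<in> A1_weights" and b: "b \<in> BMO w" and Q: "Q \<in> cubes"
  shows "expL_norm Q w (\<lambda>x. (b x - mean b Q) / w x)
    \<le> ennreal (2 * exp 1 * (32/3 * 2 ^ CARD('n))) * A1_const w * bmo_norm w b"
proof -
  have w: "weight w" and "A1_const w < \<infinity>" using A by (auto simp: A1_weights_def)
  then obtain a where a: "A1_const w = ennreal a" "0 \<le> a" by (cases "A1_const w") auto
  have bl: "locally_integrable b" and "bmo_norm w b < \<infinity>" using b by (auto simp: BMO_def)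
  then obtain B where B: "bmo_norm w b = ennreal B" "0 \<le> B" by (cases "bmo_norm w b") auto
  have [measurable]: "b \<in> borel_measurable lebesgue" "w \<in> borel_measurable lebesgue"
    using bl w by (auto simp: weight_def locally_integrable_measurable)
  from A1_weight_dichotomy[OF A] show ?thesis
  proof
    assume z: "AE x in lebesgue. w x = 0"
    have "expL_norm Q w (\<lambda>x. (b x - mean b Q) / w x) = 0"
      by (rule expL_norm_0, rule weighted_avg_AE_0, use z in eventually_elim) simp
    then show ?thesis by simp
  next
    assume pos: "AE x in lebesgue. 0 < w x"
    show ?thesis
    proof (cases "B = 0")
      case True
      then have "bmo_norm w b = 0" using B by simp
      then have "expL_norm Q w (\<lambda>x. (b x - mean b Q) / w x) = 0"
        using weighted_avg_oscillation_0[OF w pos bl _ Q, where F = "\<lambda>z. exp (\<bar>z\<bar> / l) - 1" for l]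
        by (intro expL_norm_0) simp
      then show ?thesis by simp
    next
      case False
      define G where "G = 32/3 * 2 ^ CARD('n) * a * B"
      have "1 \<le> a" by (rule A1_const_ge_1[OF w pos a])
      then have G: "0 < G" using False B(2) by (simp add: G_def)
      have "weighted_avg w Q (\<lambda>x. ennreal (exp (\<bar>(b x - mean b Q) / w x\<bar> / (2 * exp 1 * G)) - 1)) \<le> 1"
      proof (rule weighted_avg_exp_le_1[OF w pos Q _ G])
        show "(\<lambda>x. (b x - mean b Q) / w x) \<in> borel_measurable lebesgue" by simp
        show "weighted_avg w Q (\<lambda>x. ennreal (\<bar>(b x - mean b Q) / w x\<bar> ^ Suc k)) \<le> ennreal ((G * real (Suc k)) ^ Suc k)" for k
          unfolding G_def by (rule A1_moment_le[OF A pos b Q a B])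
      qed
      then have "expL_norm Q w (\<lambda>x. (b x - mean b Q) / w x) \<le> ennreal (2 * exp 1 * G)"
        unfolding expL_norm_def using G by (intro Inf_lower) auto
      also have "\<dots> = ennreal (2 * exp 1 * (32/3 * 2 ^ CARD('n))) * A1_const w * bmo_norm w b"
        unfolding a(1) B(1) G_def using a(2) B(2) by (simp add: ennreal_mult[symmetric] mult_ac)
      finally show ?thesis .
    qed
  qed
qed

theorem theorem1p7:
  shows "\<exists>c\<^sub>n c :: real. 0 < c\<^sub>n \<and> 0 < c \<and>
    (\<forall>w :: real ^ 'n \<Rightarrow> real. weight w \<longrightarrow> (\<forall>b \<in> BMO w.
      (w \<in> A1_weights \<longrightarrow>
        (\<forall>q > 1. \<forall>Q \<in> cubes.
          enn_powr (weighted_avg w Q (\<lambda>x. ennreal (\<bar>(b x - mean b Q) / w x\<bar> powr q))) (1 / q)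
          \<le> ennreal c\<^sub>n * bmo_norm w b * ennreal q
             * enn_powr (A1_const w) (1 / dual_exp q) * enn_powr (Ainf_const w) (1 / q)) \<and>
        (\<forall>Q \<in> cubes.
          expL_norm Q w (\<lambda>x. (b x - mean b Q) / w x)
          \<le> ennreal c * A1_const w * bmo_norm w b)) \<and>
      (\<forall>p > 1. w \<in> Ap_weights p \<longrightarrow>
        (\<forall>Q \<in> cubes.
          enn_powr
            (weighted_avg w Q (\<lambda>x. ennreal (\<bar>(b x - mean b Q) / w x\<bar> powr dual_exp p)))
            (1 / dual_exp p)
          \<le> ennreal c\<^sub>n * ennreal (dual_exp p) * bmo_norm w b
             * enn_powr (Ap_const p w) (1 / p) * enn_powr (Ainf_const w) (1 / dual_exp p)))))"
proof (rule exI[of _ "32/3 * 2 ^ CARD('n)"], rule exI[of _ "2 * exp 1 * (32/3 * 2 ^ CARD('n))"],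
    intro conjI allI impI ballI)
  show "(0::real) < 32/3 * 2 ^ CARD('n)" "(0::real) < 2 * exp 1 * (32/3 * 2 ^ CARD('n))" by simp_all
qed (rule A1_oscillation_le A1_expL_le Ap_oscillation_le; assumption)+

end
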